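(* For every mesh size $h>0$ (and every number $N\in\mathbb N$ of time steps), the fully discrete minimization problem $$(\mathrm P_h)\qquad\min_{\nu_h\in\mathcal V_{ad}^h}J_h(\nu_h)$$ admits at least one global minimizer $\nu_h\in\mathcal V_{ad}^h$.
   Context: Data. $\Omega\subset\mathbb R^d$ ($d\ge2$) is a bounded polyhedral Lipschitz domain, $\partial\Omega=\Gamma_N\cup\Gamma_D$ with $\Gamma_D\subsetneq\partial\Omega$ closed and $\Gamma_N=\partial\Omega\setminus\Gamma_D$ satisfying $|\Gamma_N|\neq0$. $I=[0,T]$, $T>0$. $\boldsymbol L^2(\Omega)$ is the space of $\mathbb R^d$-valued $L^2$ functions. $C^\infty_D(\Omega)=\{v|_\Omega: v\in C^\infty(\mathbb R^d),\ \mathrm{dist}(\mathrm{supp}\,v,\Gamma_D)>0\}$ and $H^1_D(\Omega)$ is its closure in $H^1(\Omega)$. Given are $p_0\in H^1_D(\Omega)$, $p_1\in L^\infty(\Omega)$, $f\in L^1(I,L^2(\Omega))$, a nonnegative $\eta\in L^\infty(\Omega)$, $m\in\mathbb N$, $p_i^{ob}\in W^{1,1}(I,L^2(\Omega))$ and nonnegative $a_i\in C^1(I,L^\infty(\Omega))$ for $i=1,\dots,m$, reals $0<\nu_-\le\nu_+$, and a real constant $\lambda$ (regularization parameter). Put $F(t)=\int_0^t f(s)\,ds$. Discretization. $\{\mathcal T_h\}_{h>0}$ is a quasi-uniform family of triangulations of $\Omega$, $h$ being the largest element diameter of $\mathcal T_h$, such that every boundary face of every element is contained either in $\Gamma_D$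 or in $\overline{\Gamma_N}$. $P_1^h$ is the space of continuous functions on $\overline\Omega$ that are affine on every element, $P_{1,D}^h=\{\phi_h\in P_1^h:\phi_h=0\text{ on }\Gamma_D\}=P_1^h\cap H^1_D(\Omega)$, and $\mathrm{DG}_0^h$ (resp. $\mathbf{DG}_0^h$) is the space of real-valued (resp. $\mathbb R^d$-valued) functions that are constant on every element. For $N\in\mathbb N$: $\tau=T/N$, $t_l=l\tau$, $t_{l+\frac12}=t_l+\frac\tau2$, $F^{l+\frac12}=F(t_{l+\frac12})$. $\Psi_h:H^1_D(\Omega)\to P_{1,D}^h$ is the $H^1(\Omega)$-orthogonal projection: $(\Psi_hp,\phi_h)_{H^1(\Omega)}=(p,\phi_h)_{H^1(\Omega)}$ for all $\phi_h\in P_{1,D}^h$, with $(u,v)_{H^1(\Omega)}=\int_\Omega\nabla u\cdot\nabla v+uv\,dx$. $\Phi_h:L^\infty(\Omega)\to\mathbf{DG}_0^h$ is $\Phi_h(\nu)=\nabla y_h$, where $y_h\in P_{1,D}^h$ is the unique solution of $\int_\Omega\nabla y_h\cdot\nabla\phi_h\,dx=\int_\Omega(\eta p_0+\nu p_1)\phi_h\,dx$ for all $\phi_h\in P_{1,D}^h$. Notation: $\delta p_h^{l+\frac12}=\frac{p_h^{l+1}-p_h^l}\tau$ and $p_h^{l+\frac12}=\frac{p_h^{l+1}+p_h^l}2$ for $l=0,\dots,N-1$; $\delta\boldsymbol u_h^l=\frac{\boldsymbol u_h^{l+\frac12}-\boldsymbol u_h^{l-\frac12}}\tau$ for $l=1,\dots,N-1$.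 The discrete admissible set is $\mathcal V_{ad}^h=\{\nu\in\mathrm{DG}_0^h:\nu_-\le\nu(x)\le\nu_+\ \forall x\in\Omega\}$. Leapfrog scheme associated with $\nu_h\in\mathcal V_{ad}^h$ (it has a unique solution): find $\{p_h^l\}_{l=0}^N\subset P_{1,D}^h$, $\{\boldsymbol u_h^{l+\frac12}\}_{l=0}^{N-1}\subset\mathbf{DG}_0^h$ with $$\int_\Omega(\nu_h\delta p_h^{l+\frac12}+\eta p_h^{l+\frac12})\phi_h-\boldsymbol u_h^{l+\frac12}\cdot\nabla\phi_h\,dx=\int_\Omega F^{l+\frac12}\phi_h\,dx\quad\forall\phi_h\in P_{1,D}^h,\ l=0,\dots,N-1,$$ $$\delta\boldsymbol u_h^l+\nabla p_h^l=0\quad\forall l=1,\dots,N-1,\qquad p_h^0=\Psi_hp_0,\quad\boldsymbol u_h^{\frac12}=\Phi_h(\nu_h).$$ The discrete reduced cost functional is $$J_h(\nu_h)=\frac\tau2\sum_{i=1}^m\sum_{l=0}^{N-1}\int_\Omega a_i(t_{l+\frac12})\big(p_h^{l+\frac12}-p_i^{ob}(t_{l+\frac12})\big)^2dx+\frac\lambda2\|\nu_h\|_{L^2(\Omega)}^2,$$ where $\{p_h^l\}_{l=0}^N$ is the first component of the solution of the leapfrog scheme associated with $\nu_h$. *)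

theory Defs
  imports "HOL-Analysis.Analysis" "HOL-Probability.Essential_Supremum"
begin

section \<open>Domains and surface measure\<close>

text \<open>Locally \<open>\<Omega>\<close> lies strictly above the graph of a Lipschitz function; \<open>e\<close> is the vertical direction
  of the local coordinates and \<open>y - (y \<bullet> e) *\<^sub>R e\<close> are the horizontal coordinates of \<open>y\<close>.\<close>

definition Lipschitz_domain :: "'a::euclidean_space set \<Rightarrow> bool" where
  "Lipschitz_domain \<Omega> \<longleftrightarrow> open \<Omega> \<and> connected \<Omega> \<and> \<Omega> \<noteq> {} \<and>
     (\<forall>x\<in>frontier \<Omega>. \<exists>U e g L. open U \<and> x \<in> U \<and> norm e = 1 \<and> L-lipschitz_on UNIV g \<and>
        \<Omega> \<inter> U = {y \<in> U. g (y - (y \<bullet> e) *\<^sub>R e) < y \<bullet> e})"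

definition polyhedral_Lipschitz_domain :: "'a::euclidean_space set \<Rightarrow> bool" where
  "polyhedral_Lipschitz_domain \<Omega> \<longleftrightarrow> bounded \<Omega> \<and> Lipschitz_domain \<Omega> \<and>
     (\<exists>\<P>. finite \<P> \<and> (\<forall>P\<in>\<P>. polytope P) \<and> closure \<Omega> = \<Union>\<P>)"

text \<open>\<open>s\<close>-dimensional Hausdorff (outer) measure for \<open>s \<ge> 1\<close>, normalised to agree with the surface measure.\<close>

definition hausdorff_pre :: "nat \<Rightarrow> real \<Rightarrow> 'a::euclidean_space set \<Rightarrow> ennreal" where
  "hausdorff_pre s \<delta> A = Inf {(\<Sum>n. ennreal (unit_ball_vol (real s) * (diameter (U n) / 2) ^ s)) | U :: nat \<Rightarrow> 'a set.
      A \<subseteq> (\<Union>n. U n) \<and> (\<forall>n. bounded (U n) \<and> diameter (U n) \<le> \<delta>)}"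

definition hausdorff_measure :: "nat \<Rightarrow> 'a::euclidean_space set \<Rightarrow> ennreal" where
  "hausdorff_measure s A = (SUP \<delta>\<in>{0<..}. hausdorff_pre s \<delta> A)"

section \<open>Lebesgue and Sobolev spaces\<close>

text \<open>Elements of \<open>L\<^sup>p(\<Omega>)\<close> are represented by functions on the whole space, of which only the
  values almost everywhere on \<open>\<Omega>\<close> matter.\<close>

definition L2 :: "'a::euclidean_space set \<Rightarrow> ('a \<Rightarrow> 'b::euclidean_space) set" where
  "L2 \<Omega> = {v \<in> borel_measurable (lebesgue_on \<Omega>). integrable (lebesgue_on \<Omega>) (\<lambda>x. (norm (v x))\<^sup>2)}"

definition L2_norm :: "'a::euclidean_space set \<Rightarrow> ('a \<Rightarrow> 'b::euclidean_space) \<Rightarrow> real" where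
  "L2_norm \<Omega> v = sqrt (\<integral>x. (norm (v x))\<^sup>2 \<partial>lebesgue_on \<Omega>)"

definition Linf_norm :: "'a::euclidean_space set \<Rightarrow> ('a \<Rightarrow> real) \<Rightarrow> ereal" where
  "Linf_norm \<Omega> v = esssup (lebesgue_on \<Omega>) (\<lambda>x. ereal \<bar>v x\<bar>)"

definition Linf :: "'a::euclidean_space set \<Rightarrow> ('a \<Rightarrow> real) set" where
  "Linf \<Omega> = {v \<in> borel_measurable (lebesgue_on \<Omega>). Linf_norm \<Omega> v < \<infinity>}"

definition gradient :: "('a::euclidean_space \<Rightarrow> real) \<Rightarrow> 'a \<Rightarrow> 'a" where
  "gradient v x = (THE D. GDERIV v x :> D)"

primrec Ck :: "nat \<Rightarrow> ('a::euclidean_space \<Rightarrow> real) \<Rightarrow> bool" where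
  "Ck 0 v = continuous_on UNIV v"
| "Ck (Suc k) v = (v differentiable_on UNIV \<and> (\<forall>b\<in>Basis. Ck k (\<lambda>x. gradient v x \<bullet> b)))"

definition smooth :: "('a::euclidean_space \<Rightarrow> real) \<Rightarrow> bool" where
  "smooth v \<longleftrightarrow> (\<forall>k. Ck k v)"

definition supp :: "('a::euclidean_space \<Rightarrow> real) \<Rightarrow> 'a set" where
  "supp v = closure {x. v x \<noteq> 0}"

definition test_functions :: "'a::euclidean_space set \<Rightarrow> ('a \<Rightarrow> real) set" where
  "test_functions \<Omega> = {\<phi>. smooth \<phi> \<and> compact (supp \<phi>) \<and> supp \<phi> \<subseteq> \<Omega>}"

definition has_weak_gradient :: "'a::euclidean_space set \<Rightarrow> ('a \<Rightarrow> real) \<Rightarrow> ('a \<Rightarrow> 'a) \<Rightarrow> bool" where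
  "has_weak_gradient \<Omega> v g \<longleftrightarrow>
     (\<forall>\<phi>\<in>test_functions \<Omega>. \<forall>b\<in>Basis.
        (\<integral>x. v x * (gradient \<phi> x \<bullet> b) \<partial>lebesgue_on \<Omega>) = - (\<integral>x. (g x \<bullet> b) * \<phi> x \<partial>lebesgue_on \<Omega>))"

definition H1 :: "'a::euclidean_space set \<Rightarrow> ('a \<Rightarrow> real) set" where
  "H1 \<Omega> = {v \<in> L2 \<Omega>. \<exists>g\<in>L2 \<Omega>. has_weak_gradient \<Omega> v g}"

definition weak_gradient :: "'a::euclidean_space set \<Rightarrow> ('a \<Rightarrow> real) \<Rightarrow> 'a \<Rightarrow> 'a" where
  "weak_gradient \<Omega> v = (SOME g. g \<in> L2 \<Omega> \<and> has_weak_gradient \<Omega> v g)"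

definition H1_norm :: "'a::euclidean_space set \<Rightarrow> ('a \<Rightarrow> real) \<Rightarrow> real" where
  "H1_norm \<Omega> v = sqrt ((L2_norm \<Omega> (weak_gradient \<Omega> v))\<^sup>2 + (L2_norm \<Omega> v)\<^sup>2)"

text \<open>Positive distance is written out, because \<^term>\<open>setdist\<close> is \<open>0\<close> if one of the sets is empty.\<close>

definition Cinf_D :: "'a::euclidean_space set \<Rightarrow> ('a \<Rightarrow> real) set" where
  "Cinf_D \<Gamma>D = {v. smooth v \<and> (\<exists>\<epsilon>>0. \<forall>x\<in>supp v. \<forall>y\<in>\<Gamma>D. \<epsilon> \<le> dist x y)}"

definition H1_D :: "'a::euclidean_space set \<Rightarrow> 'a set \<Rightarrow> ('a \<Rightarrow> real) set" where
  "H1_D \<Omega> \<Gamma>D = {v \<in> H1 \<Omega>. \<forall>\<epsilon>>0. \<exists>w\<in>Cinf_D \<Gamma>D. H1_norm \<Omega> (\<lambda>x. v x - w x) < \<epsilon>}"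

section \<open>Functions of time with values in \<open>L\<^sup>2(\<Omega>)\<close> and \<open>L\<^sup>\<infinity>(\<Omega>)\<close>\<close>

text \<open>A simple function \<open>S \<rightarrow> L\<^sup>2(\<Omega>)\<close> is a list of pairs \<open>(A, g)\<close>, standing for the sum of the
  functions \<open>indicator A \<cdot> g\<close>. The Bochner integral is the \<open>L\<^sup>2(\<Omega>)\<close>-limit of the integrals of
  approximating simple functions, as in \<^const>\<open>has_bochner_integral\<close>; strong measurability follows
  from the convergence required in \<open>simple_approx\<close>. All time sets \<open>S\<close> are bounded intervals.\<close>

type_synonym 'a L2_simple = "(real set \<times> ('a \<Rightarrow> real)) list"

definition simple_fun :: "'a L2_simple \<Rightarrow> real \<Rightarrow> 'a \<Rightarrow> real" where
  "simple_fun s t x = (\<Sum>(A, g)\<leftarrow>s. indicator A t * g x)"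

definition simple_integral :: "'a L2_simple \<Rightarrow> 'a \<Rightarrow> real" where
  "simple_integral s x = (\<Sum>(A, g)\<leftarrow>s. measure lebesgue A * g x)"

definition simple_approx ::
  "'a::euclidean_space set \<Rightarrow> real set \<Rightarrow> (nat \<Rightarrow> 'a L2_simple) \<Rightarrow> (real \<Rightarrow> 'a \<Rightarrow> real) \<Rightarrow> bool" where
  "simple_approx \<Omega> S s f \<longleftrightarrow>
     (AE t in lebesgue_on S. f t \<in> L2 \<Omega>) \<and>
     (\<forall>k. \<forall>(A, g)\<in>set (s k). A \<in> sets lebesgue \<and> A \<subseteq> S \<and> g \<in> L2 \<Omega>) \<and>
     (\<forall>k. (\<lambda>t. L2_norm \<Omega> (\<lambda>x. f t x - simple_fun (s k) t x)) \<in> borel_measurable (lebesgue_on S)) \<and>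
     (\<lambda>k. \<integral>\<^sup>+ t. ennreal (L2_norm \<Omega> (\<lambda>x. f t x - simple_fun (s k) t x)) \<partial>lebesgue_on S) \<longlonglongrightarrow> 0"

definition L1_L2 :: "'a::euclidean_space set \<Rightarrow> real set \<Rightarrow> (real \<Rightarrow> 'a \<Rightarrow> real) set" where
  "L1_L2 \<Omega> S = {f. \<exists>s. simple_approx \<Omega> S s f}"

definition L2_integral :: "'a::euclidean_space set \<Rightarrow> real set \<Rightarrow> (real \<Rightarrow> 'a \<Rightarrow> real) \<Rightarrow> 'a \<Rightarrow> real" where
  "L2_integral \<Omega> S f = (SOME F. F \<in> L2 \<Omega> \<and> (\<exists>s. simple_approx \<Omega> S s f \<and>
      (\<lambda>k. L2_norm \<Omega> (\<lambda>x. simple_integral (s k) x - F x)) \<longlonglongrightarrow> 0))"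

text \<open>Functions in \<open>W\<^sup>1\<^sup>,\<^sup>1([0,T], L\<^sup>2(\<Omega>))\<close> are represented by their continuous
  representatives, so that point values make sense.\<close>

definition W11_L2 :: "'a::euclidean_space set \<Rightarrow> real \<Rightarrow> (real \<Rightarrow> 'a \<Rightarrow> real) set" where
  "W11_L2 \<Omega> T = {p \<in> L1_L2 \<Omega> {0..T}.
     (\<forall>t\<in>{0..T}. p t \<in> L2 \<Omega> \<and>
        ((\<lambda>s. L2_norm \<Omega> (\<lambda>x. p s x - p t x)) \<longlongrightarrow> 0) (at t within {0..T})) \<and>
     (\<exists>g\<in>L1_L2 \<Omega> {0..T}. \<forall>\<phi>\<in>test_functions {0<..<T}.
        AE x in lebesgue_on \<Omega>. L2_integral \<Omega> {0..T} (\<lambda>t x. deriv \<phi> t * p t x) x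
                               = - L2_integral \<Omega> {0..T} (\<lambda>t x. \<phi> t * g t x) x)}"

definition C1_Linf :: "'a::euclidean_space set \<Rightarrow> real \<Rightarrow> (real \<Rightarrow> 'a \<Rightarrow> real) set" where
  "C1_Linf \<Omega> T = {a. (\<forall>t\<in>{0..T}. a t \<in> Linf \<Omega>) \<and>
     (\<exists>a'. \<forall>t\<in>{0..T}. a' t \<in> Linf \<Omega> \<and>
        ((\<lambda>s. Linf_norm \<Omega> (\<lambda>x. (a s x - a t x) / (s - t) - a' t x)) \<longlongrightarrow> 0) (at t within {0..T}) \<and>
        ((\<lambda>s. Linf_norm \<Omega> (\<lambda>x. a' s x - a' t x)) \<longlongrightarrow> 0) (at t within {0..T}))}"

section \<open>Triangulations and finite element spaces\<close>

definition mesh :: "'a::euclidean_space set \<Rightarrow> 'a set \<Rightarrow> 'a set \<Rightarrow> 'a set set \<Rightarrow> bool" where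
  "mesh \<Omega> \<Gamma>D \<Gamma>N \<T> \<longleftrightarrow> triangulation \<T> \<and> (\<forall>K\<in>\<T>. int DIM('a) simplex K) \<and> \<Union>\<T> = closure \<Omega> \<and>
     (\<forall>K\<in>\<T>. \<forall>E. E facet_of K \<and> E \<subseteq> frontier \<Omega> \<longrightarrow> E \<subseteq> \<Gamma>D \<or> E \<subseteq> closure \<Gamma>N)"

text \<open>The family is indexed by the set \<open>H\<close> of its mesh sizes (a bounded domain has no mesh of size
  \<open>h\<close> for large \<open>h\<close>). Quasi-uniformity: every element contains a ball of radius comparable to \<open>h\<close>.\<close>

definition quasi_uniform_family ::
  "'a::euclidean_space set \<Rightarrow> 'a set \<Rightarrow> 'a set \<Rightarrow> real set \<Rightarrow> (real \<Rightarrow> 'a set set) \<Rightarrow> bool" where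
  "quasi_uniform_family \<Omega> \<Gamma>D \<Gamma>N H \<T> \<longleftrightarrow> H \<subseteq> {0<..} \<and>
     (\<forall>h\<in>H. mesh \<Omega> \<Gamma>D \<Gamma>N (\<T> h) \<and> h = Max (diameter ` \<T> h)) \<and>
     (\<exists>\<kappa>>0. \<forall>h\<in>H. \<forall>K\<in>\<T> h. \<exists>x. ball x (\<kappa> * h) \<subseteq> K)"

text \<open>Functions on \<open>closure \<Omega>\<close> are normalised to vanish outside \<open>closure \<Omega>\<close>, so that equal
  functions on \<open>closure \<Omega>\<close> are equal in HOL. The gradient of a function in \<open>P1\<close> is its classical
  gradient inside the elements, which is its weak gradient.\<close>

definition P1 :: "'a::euclidean_space set \<Rightarrow> 'a set set \<Rightarrow> ('a \<Rightarrow> real) set" where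
  "P1 \<Omega> \<T> = {\<phi>. continuous_on (closure \<Omega>) \<phi> \<and> (\<forall>K\<in>\<T>. \<exists>a c. \<forall>x\<in>K. \<phi> x = a \<bullet> x + c) \<and>
               (\<forall>x. x \<notin> closure \<Omega> \<longrightarrow> \<phi> x = 0)}"

definition P1_D :: "'a::euclidean_space set \<Rightarrow> 'a set \<Rightarrow> 'a set set \<Rightarrow> ('a \<Rightarrow> real) set" where
  "P1_D \<Omega> \<Gamma>D \<T> = {\<phi> \<in> P1 \<Omega> \<T>. \<forall>x\<in>\<Gamma>D. \<phi> x = 0}"

text \<open>Elements are closed simplices, so constancy is required on their interiors; the values on
  the skeleton, a null set, are immaterial.\<close>

definition DG0 :: "'a::euclidean_space set set \<Rightarrow> ('a \<Rightarrow> 'b::euclidean_space) set" where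
  "DG0 \<T> = {v. \<forall>K\<in>\<T>. v constant_on interior K}"

definition V_ad :: "'a::euclidean_space set \<Rightarrow> 'a set set \<Rightarrow> real \<Rightarrow> real \<Rightarrow> ('a \<Rightarrow> real) set" where
  "V_ad \<Omega> \<T> \<nu>min \<nu>max = {\<nu> \<in> DG0 \<T>. \<forall>x\<in>\<Omega>. \<nu>min \<le> \<nu> x \<and> \<nu> x \<le> \<nu>max}"

definition \<Psi> :: "'a::euclidean_space set \<Rightarrow> 'a set \<Rightarrow> 'a set set \<Rightarrow> ('a \<Rightarrow> real) \<Rightarrow> 'a \<Rightarrow> real" where
  "\<Psi> \<Omega> \<Gamma>D \<T> p = (THE q. q \<in> P1_D \<Omega> \<Gamma>D \<T> \<and> (\<forall>\<phi>\<in>P1_D \<Omega> \<Gamma>D \<T>.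
      (\<integral>x. gradient q x \<bullet> gradient \<phi> x + q x * \<phi> x \<partial>lebesgue_on \<Omega>)
      = (\<integral>x. weak_gradient \<Omega> p x \<bullet> gradient \<phi> x + p x * \<phi> x \<partial>lebesgue_on \<Omega>)))"

text \<open>The solution \<open>y\<close> exists and is unique for a connected domain if \<open>\<Gamma>D\<close> is nonempty; for
  \<open>\<Gamma>D = {}\<close> this is a pure Neumann problem and \<open>\<Phi>\<close> is undefined.\<close>

definition \<Phi> :: "'a::euclidean_space set \<Rightarrow> 'a set \<Rightarrow> 'a set set \<Rightarrow> ('a \<Rightarrow> real) \<Rightarrow> ('a \<Rightarrow> real) \<Rightarrow> ('a \<Rightarrow> real)
    \<Rightarrow> ('a \<Rightarrow> real) \<Rightarrow> 'a \<Rightarrow> 'a" where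
  "\<Phi> \<Omega> \<Gamma>D \<T> \<eta> p\<^sub>0 p\<^sub>1 \<nu> = gradient (THE y. y \<in> P1_D \<Omega> \<Gamma>D \<T> \<and> (\<forall>\<phi>\<in>P1_D \<Omega> \<Gamma>D \<T>.
      (\<integral>x. gradient y x \<bullet> gradient \<phi> x \<partial>lebesgue_on \<Omega>)
      = (\<integral>x. (\<eta> x * p\<^sub>0 x + \<nu> x * p\<^sub>1 x) * \<phi> x \<partial>lebesgue_on \<Omega>)))"

section \<open>The leapfrog scheme and the cost functional\<close>

definition t_half :: "real \<Rightarrow> nat \<Rightarrow> nat \<Rightarrow> real" where
  "t_half T N l = real l * (T / real N) + (T / real N) / 2"

definition p_half :: "(nat \<Rightarrow> 'a \<Rightarrow> real) \<Rightarrow> nat \<Rightarrow> 'a \<Rightarrow> real" where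
  "p_half p l x = (p (Suc l) x + p l x) / 2"

definition \<delta>p_half :: "real \<Rightarrow> (nat \<Rightarrow> 'a \<Rightarrow> real) \<Rightarrow> nat \<Rightarrow> 'a \<Rightarrow> real" where
  "\<delta>p_half \<tau> p l x = (p (Suc l) x - p l x) / \<tau>"

text \<open>\<open>u l\<close> stands for \<open>\<^bold>u\<close> at the time level \<open>l + 1/2\<close>; equations between functions in \<open>DG0\<close> are
  imposed on the interiors of the elements.\<close>

definition leapfrog ::
  "'a::euclidean_space set \<Rightarrow> 'a set \<Rightarrow> 'a set set \<Rightarrow> real \<Rightarrow> nat \<Rightarrow> (real \<Rightarrow> 'a \<Rightarrow> real) \<Rightarrow> ('a \<Rightarrow> real) \<Rightarrow>
   ('a \<Rightarrow> real) \<Rightarrow> ('a \<Rightarrow> real) \<Rightarrow> ('a \<Rightarrow> real) \<Rightarrow> (nat \<Rightarrow> 'a \<Rightarrow> real) \<Rightarrow> (nat \<Rightarrow> 'a \<Rightarrow> 'a) \<Rightarrow> bool" where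
  "leapfrog \<Omega> \<Gamma>D \<T> T N f \<eta> p\<^sub>0 p\<^sub>1 \<nu> p u \<longleftrightarrow>
     (let \<tau> = T / real N; F = (\<lambda>t. L2_integral \<Omega> {0..t} f) in
      (\<forall>l\<le>N. p l \<in> P1_D \<Omega> \<Gamma>D \<T>) \<and> (\<forall>l<N. u l \<in> DG0 \<T>) \<and>
      (\<forall>l<N. \<forall>\<phi>\<in>P1_D \<Omega> \<Gamma>D \<T>.
         (\<integral>x. (\<nu> x * \<delta>p_half \<tau> p l x + \<eta> x * p_half p l x) * \<phi> x - u l x \<bullet> gradient \<phi> x \<partial>lebesgue_on \<Omega>)
         = (\<integral>x. F (t_half T N l) x * \<phi> x \<partial>lebesgue_on \<Omega>)) \<and>
      (\<forall>l\<in>{1..<N}. \<forall>K\<in>\<T>. \<forall>x\<in>interior K. (u l x - u (l - 1) x) /\<^sub>R \<tau> + gradient (p l) x = 0) \<and>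
      p 0 = \<Psi> \<Omega> \<Gamma>D \<T> p\<^sub>0 \<and>
      (\<forall>K\<in>\<T>. \<forall>x\<in>interior K. u 0 x = \<Phi> \<Omega> \<Gamma>D \<T> \<eta> p\<^sub>0 p\<^sub>1 \<nu> x))"

text \<open>The choice is harmless: \<open>p 0, \<dots>, p N\<close>, the only members of \<open>p\<close> used below, are uniquely
  determined by the scheme.\<close>

definition leapfrog_p ::
  "'a::euclidean_space set \<Rightarrow> 'a set \<Rightarrow> 'a set set \<Rightarrow> real \<Rightarrow> nat \<Rightarrow> (real \<Rightarrow> 'a \<Rightarrow> real) \<Rightarrow> ('a \<Rightarrow> real) \<Rightarrow>
   ('a \<Rightarrow> real) \<Rightarrow> ('a \<Rightarrow> real) \<Rightarrow> ('a \<Rightarrow> real) \<Rightarrow> nat \<Rightarrow> 'a \<Rightarrow> real" where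
  "leapfrog_p \<Omega> \<Gamma>D \<T> T N f \<eta> p\<^sub>0 p\<^sub>1 \<nu> = (SOME p. \<exists>u. leapfrog \<Omega> \<Gamma>D \<T> T N f \<eta> p\<^sub>0 p\<^sub>1 \<nu> p u)"

text \<open>\<open>reg\<close> is the regularization parameter.\<close>

definition J ::
  "'a::euclidean_space set \<Rightarrow> 'a set \<Rightarrow> 'a set set \<Rightarrow> real \<Rightarrow> nat \<Rightarrow> (real \<Rightarrow> 'a \<Rightarrow> real) \<Rightarrow> ('a \<Rightarrow> real) \<Rightarrow>
   ('a \<Rightarrow> real) \<Rightarrow> ('a \<Rightarrow> real) \<Rightarrow> nat \<Rightarrow> (nat \<Rightarrow> real \<Rightarrow> 'a \<Rightarrow> real) \<Rightarrow> (nat \<Rightarrow> real \<Rightarrow> 'a \<Rightarrow> real) \<Rightarrow> real \<Rightarrow>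
   ('a \<Rightarrow> real) \<Rightarrow> real" where
  "J \<Omega> \<Gamma>D \<T> T N f \<eta> p\<^sub>0 p\<^sub>1 m a p_ob reg \<nu> =
     (let p = leapfrog_p \<Omega> \<Gamma>D \<T> T N f \<eta> p\<^sub>0 p\<^sub>1 \<nu> in
      (T / real N) / 2 * (\<Sum>i=1..m. \<Sum>l<N.
         (\<integral>x. a i (t_half T N l) x * (p_half p l x - p_ob i (t_half T N l) x)\<^sup>2 \<partial>lebesgue_on \<Omega>))
      + reg / 2 * (L2_norm \<Omega> \<nu>)\<^sup>2)"

end

theory Submission imports Defs begin

text \<open>
  Up to a null set, the admissible parameters are the cellwise constant functions with values in a
  box, which is compact in the product topology, so it suffices that the cost is continuous in the
  cell values. Every equation of the scheme is a Galerkin problem on the finite-dimensional space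
  \<open>P1_D\<close> with a positive definite form whose coefficients depend continuously on the cell values;
  Gaussian elimination keeps this continuity, and induction over the time steps transports it to
  \<open>p 0, \<dots>, p N\<close>. For the induction one writes \<open>u l = \<nabla>y l\<close> with \<open>y l\<close> in \<open>P1_D\<close>: this holds for
  \<open>u 0\<close> by definition of \<open>\<Phi>\<close>, and the second equation of the scheme becomes
  \<open>y (l + 1) = y l - \<tau> p (l + 1)\<close>.
\<close>

section \<open>Integrals depending on a parameter\<close>

text \<open>The development never proves outright that the scheme is solvable: \<open>\<Psi>\<close>
  and \<open>F\<close> enter through description and choice operators. What the recursion needs of
  them, that the initial value lies in \<open>P1_D\<close> and that the load is linear, does not
  involve the parameter and conversely follows from solvability for a single parameter. Hence either
  all parameters have a solution, which varies continuously, or none has, and the misfit term is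
  constant.

  The second obstacle is the mesh skeleton, where gradients and admissible parameters have
  uncontrolled values. Since Lebesgue measure is complete, almost everywhere equality transfers
  measurability as well, and the congruence rules carry no measurability hypotheses.

  Integrals depend continuously on the parameter without any limit theorem: each integrand is, up to
  null sets, a finite sum of continuous coefficients times fixed functions.\<close>

lemma (in complete_measure) measurable_cong_AE:
  assumes f: "f \<in> M \<rightarrow>\<^sub>M N" and g: "g \<in> space M \<rightarrow> space N" and eq: "AE x in M. f x = g x"
  shows "g \<in> M \<rightarrow>\<^sub>M N"
proof (rule measurableI)
  fix A assume A: "A \<in> sets N"
  show "g -` A \<inter> space M \<in> sets M"
  proof (rule in_sets_AE)
    show "AE x in M. (x \<in> f -` A \<inter> space M) = (x \<in> g -` A \<inter> space M)"
      using eq by eventually_elim auto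
  qed (use f A in auto)
qed (use g in auto)

lemma complete_measure_lebesgue_on:
  assumes "S \<in> sets lebesgue" shows "complete_measure (lebesgue_on S)"
proof
  fix A B assume "A \<subseteq> B" and B: "B \<in> null_sets (lebesgue_on S)"
  then have "A \<subseteq> B" "B \<in> null_sets lebesgue" "B \<subseteq> S"
    using assms by (auto simp: null_sets_restrict_space)
  then have "A \<in> null_sets lebesgue" by (blast intro: null_sets_completion_subset)
  with \<open>A \<subseteq> B\<close> \<open>B \<subseteq> S\<close> show "A \<in> sets (lebesgue_on S)"
    using assms by (auto simp: sets_restrict_space_iff)
qed

context complete_measure begin

lemma borel_measurable_cong_AE:
  fixes f g :: "'a \<Rightarrow> 'b::topological_space"
  assumes "AE x in M. f x = g x"
  shows "f \<in> borel_measurable M \<longleftrightarrow> g \<in> borel_measurable M"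
proof -
  have "AE x in M. g x = f x" using assms by eventually_elim simp
  then show ?thesis
    using measurable_cong_AE[of f borel g, OF _ _ assms] measurable_cong_AE[of g borel f] by (intro iffI) simp_all
qed

lemma integrable_cong_AE_complete:
  fixes f g :: "'a \<Rightarrow> 'b::{banach,second_countable_topology}"
  assumes "AE x in M. f x = g x"
  shows "integrable M f \<longleftrightarrow> integrable M g"
proof (cases "f \<in> borel_measurable M")
  case True
  then show ?thesis using borel_measurable_cong_AE[OF assms] integrable_cong_AE[OF _ _ assms] by simp
next
  case False
  then show ?thesis using borel_measurable_cong_AE[OF assms] borel_measurable_integrable by metis
qed

lemma integral_cong_AE_complete:
  fixes f g :: "'a \<Rightarrow> 'b::{banach,second_countable_topology}"
  assumes "AE x in M. f x = g x"
  shows "(\<integral>x. f x \<partial>M) = (\<integral>x. g x \<partial>M)"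
proof (cases "f \<in> borel_measurable M")
  case True
  then show ?thesis using borel_measurable_cong_AE[OF assms] integral_cong_AE[OF _ _ assms] by simp
next
  case False
  \<comment> \<open>Neither function is measurable, so both integrals take the default value
    0.\<close>
  then have "\<not> integrable M f" "\<not> integrable M g"
    using borel_measurable_cong_AE[OF assms] by (auto dest: borel_measurable_integrable)
  then show ?thesis by (simp add: not_integrable_integral_eq)
qed

end

section \<open>Bounded and square integrable functions\<close>

text \<open>A real bound, unlike the extended real essential supremum, passes directly through sums
  and products. It also exists if the essential supremum is \<open>-\<infinity>\<close>, which
  happens on a null domain.\<close>

lemma Linf_iff:
  "v \<in> Linf \<Omega> \<longleftrightarrow> v \<in> borel_measurable (lebesgue_on \<Omega>) \<and> (\<exists>B. AE x in lebesgue_on \<Omega>. \<bar>v x\<bar> \<le> B)"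
proof
  assume v: "v \<in> Linf \<Omega>"
  let ?e = "esssup (lebesgue_on \<Omega>) (\<lambda>x. ereal \<bar>v x\<bar>)"
  have "AE x in lebesgue_on \<Omega>. ereal \<bar>v x\<bar> \<le> ?e" by (rule esssup_AE)
  moreover obtain B where "?e \<le> ereal B"
    using v by (cases ?e) (auto simp: Linf_def Linf_norm_def)
  ultimately have "AE x in lebesgue_on \<Omega>. \<bar>v x\<bar> \<le> B"
    by (auto elim!: eventually_mono dest: order_trans)
  then show "v \<in> borel_measurable (lebesgue_on \<Omega>) \<and> (\<exists>B. AE x in lebesgue_on \<Omega>. \<bar>v x\<bar> \<le> B)"
    using v by (auto simp: Linf_def)
next
  assume "v \<in> borel_measurable (lebesgue_on \<Omega>) \<and> (\<exists>B. AE x in lebesgue_on \<Omega>. \<bar>v x\<bar> \<le> B)"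
  then obtain B where v: "v \<in> borel_measurable (lebesgue_on \<Omega>)" and B: "AE x in lebesgue_on \<Omega>. \<bar>v x\<bar> \<le> B" by auto
  have "esssup (lebesgue_on \<Omega>) (\<lambda>x. ereal \<bar>v x\<bar>) \<le> ereal B"
    by (rule esssup_I) (use v B in auto)
  then show "v \<in> Linf \<Omega>" using v by (auto simp: Linf_def Linf_norm_def)
qed

lemma Linf_integrable_mult:
  assumes "v \<in> Linf \<Omega>" "integrable (lebesgue_on \<Omega>) g"
  shows "integrable (lebesgue_on \<Omega>) (\<lambda>x. v x * g x)"
proof -
  obtain B where B: "AE x in lebesgue_on \<Omega>. \<bar>v x\<bar> \<le> B" and v: "v \<in> borel_measurable (lebesgue_on \<Omega>)"
    using assms(1) by (auto simp: Linf_iff)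
  have "AE x in lebesgue_on \<Omega>. norm (v x * g x) \<le> norm (B * g x)"
    using B by eventually_elim (auto simp: abs_mult intro!: mult_right_mono)
  then show ?thesis
    using v assms(2) by (intro Bochner_Integration.integrable_bound[OF integrable_mult_right[OF assms(2), of B]]) auto
qed

lemma Linf_mult: "v \<in> Linf \<Omega> \<Longrightarrow> w \<in> Linf \<Omega> \<Longrightarrow> (\<lambda>x. v x * w x) \<in> Linf \<Omega>"
proof -
  assume "v \<in> Linf \<Omega>" "w \<in> Linf \<Omega>"
  then obtain B B' where B: "AE x in lebesgue_on \<Omega>. \<bar>v x\<bar> \<le> B" "AE x in lebesgue_on \<Omega>. \<bar>w x\<bar> \<le> B'"
    and m: "v \<in> borel_measurable (lebesgue_on \<Omega>)" "w \<in> borel_measurable (lebesgue_on \<Omega>)"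
    by (auto simp: Linf_iff)
  from B have "AE x in lebesgue_on \<Omega>. \<bar>v x * w x\<bar> \<le> B * B'"
    by eventually_elim (auto simp: abs_mult intro!: mult_mono')
  with m show ?thesis by (auto simp: Linf_iff)
qed

lemma Linf_add: "v \<in> Linf \<Omega> \<Longrightarrow> w \<in> Linf \<Omega> \<Longrightarrow> (\<lambda>x. v x + w x) \<in> Linf \<Omega>"
proof -
  assume "v \<in> Linf \<Omega>" "w \<in> Linf \<Omega>"
  then obtain B B' where B: "AE x in lebesgue_on \<Omega>. \<bar>v x\<bar> \<le> B" "AE x in lebesgue_on \<Omega>. \<bar>w x\<bar> \<le> B'"
    and m: "v \<in> borel_measurable (lebesgue_on \<Omega>)" "w \<in> borel_measurable (lebesgue_on \<Omega>)"
    by (auto simp: Linf_iff)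
  from B have "AE x in lebesgue_on \<Omega>. \<bar>v x + w x\<bar> \<le> B + B'"
    by eventually_elim auto
  with m show ?thesis by (auto simp: Linf_iff)
qed

lemma Linf_const: "(\<lambda>_. k) \<in> Linf \<Omega>"
  by (auto simp: Linf_iff intro!: exI[of _ "\<bar>k\<bar>"])

lemma Linf_cmult: "v \<in> Linf \<Omega> \<Longrightarrow> (\<lambda>x. k * v x) \<in> Linf \<Omega>"
  using Linf_mult[OF Linf_const] by blast

lemma Linf_sum: "(\<And>i. i \<in> I \<Longrightarrow> v i \<in> Linf \<Omega>) \<Longrightarrow> (\<lambda>x. \<Sum>i\<in>I. v i x) \<in> Linf \<Omega>"
  by (induction I rule: infinite_finite_induct) (auto intro: Linf_add Linf_const)

lemma Linf_integrable:
  assumes "\<Omega> \<in> lmeasurable" "v \<in> Linf \<Omega>"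
  shows "integrable (lebesgue_on \<Omega>) v"
proof -
  interpret finite_measure "lebesgue_on \<Omega>" by (rule finite_measure_lebesgue_on[OF assms(1)])
  show ?thesis using Linf_integrable_mult[OF assms(2), of "\<lambda>_. 1"] by simp
qed

lemma L2_integrable:
  fixes v :: "'a::euclidean_space \<Rightarrow> real"
  assumes "\<Omega> \<in> lmeasurable" "v \<in> L2 \<Omega>"
  shows "integrable (lebesgue_on \<Omega>) v"
proof -
  interpret finite_measure "lebesgue_on \<Omega>" by (rule finite_measure_lebesgue_on[OF assms(1)])
  have v: "v \<in> borel_measurable (lebesgue_on \<Omega>)" "integrable (lebesgue_on \<Omega>) (\<lambda>x. (v x)\<^sup>2)"
    using assms(2) by (auto simp: L2_def)
  have "\<bar>v x\<bar> \<le> 1 + (v x)\<^sup>2" for x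
  proof (cases "\<bar>v x\<bar> \<le> 1")
    case False
    then have "\<bar>v x\<bar> \<le> \<bar>v x\<bar>\<^sup>2" by (intro self_le_power) auto
    then show ?thesis by simp
  qed (simp add: add_increasing2)
  then have "AE x in lebesgue_on \<Omega>. norm (v x) \<le> norm (1 + (v x)\<^sup>2)" by (intro AE_I2) simp
  then show ?thesis
    by (rule Bochner_Integration.integrable_bound
          [OF Bochner_Integration.integrable_add[OF integrable_const v(2)] v(1)])
qed

section \<open>Separated families and their integrals\<close>

text \<open>Separation of variables: such a family is, up to a null set that may depend on
  \<open>c\<close>, a finite sum of products of a continuous coefficient in \<open>c\<close> and a
  fixed function from \<open>\<G>\<close>. The inductive form spares index sets and makes products a
  double induction; the almost everywhere clause in both rules builds in invariance under null
  sets.\<close>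

inductive sepfam ::
  "'c::topological_space set \<Rightarrow> 'a measure \<Rightarrow> ('a \<Rightarrow> real) set \<Rightarrow> ('c \<Rightarrow> 'a \<Rightarrow> real) \<Rightarrow> bool"
  for C M \<G> where
  scale: "continuous_on C w \<Longrightarrow> g \<in> \<G> \<Longrightarrow> (\<And>c. c \<in> C \<Longrightarrow> AE x in M. G c x = w c * g x) \<Longrightarrow> sepfam C M \<G> G"
| add: "sepfam C M \<G> G1 \<Longrightarrow> sepfam C M \<G> G2 \<Longrightarrow> (\<And>c. c \<in> C \<Longrightarrow> AE x in M. G c x = G1 c x + G2 c x)
    \<Longrightarrow> sepfam C M \<G> G"

lemma sepfam_cong:
  assumes "sepfam C M \<G> G" and eq: "\<And>c. c \<in> C \<Longrightarrow> AE x in M. G' c x = G c x"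
  shows "sepfam C M \<G> G'"
  using assms(1)
proof cases
  case (scale w g)
  have "AE x in M. G' c x = w c * g x" if "c \<in> C" for c
    using eq[OF that] scale(3)[OF that] by eventually_elim simp
  then show ?thesis by (rule sepfam.scale[OF scale(1,2)])
next
  case (add G1 G2)
  have "AE x in M. G' c x = G1 c x + G2 c x" if "c \<in> C" for c
    using eq[OF that] add(3)[OF that] by eventually_elim simp
  then show ?thesis by (rule sepfam.add[OF add(1,2)])
qed

lemma sepfam_const: "g \<in> \<G> \<Longrightarrow> sepfam C M \<G> (\<lambda>_. g)"
  by (rule sepfam.scale[of C "\<lambda>_. 1"]) auto

lemma sepfam_plus: "sepfam C M \<G> G1 \<Longrightarrow> sepfam C M \<G> G2 \<Longrightarrow> sepfam C M \<G> (\<lambda>c x. G1 c x + G2 c x)"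
  by (rule sepfam.add[where ?G1.0 = G1 and ?G2.0 = G2]) auto

lemma sepfam_cmult:
  assumes "sepfam C M \<G> G" and k: "continuous_on C k"
  shows "sepfam C M \<G> (\<lambda>c x. k c * G c x)"
  using assms(1)
proof induction
  case (scale w g G)
  show ?case
  proof (rule sepfam.scale[OF continuous_on_mult[OF k scale(1)] scale(2)])
    show "AE x in M. k c * G c x = k c * w c * g x" if "c \<in> C" for c
      using scale(3)[OF that] by eventually_elim simp
  qed
next
  case (add G1 G2 G)
  show ?case
  proof (rule sepfam.add[OF add(4,5)])
    show "AE x in M. k c * G c x = k c * G1 c x + k c * G2 c x" if "c \<in> C" for c
      using add(3)[OF that] by eventually_elim (simp add: distrib_left)
  qed
qed

lemma sepfam_sum:
  assumes "(\<lambda>_. 0) \<in> \<G>" and "\<And>i. i \<in> I \<Longrightarrow> sepfam C M \<G> (G i)"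
  shows "sepfam C M \<G> (\<lambda>c x. \<Sum>i\<in>I. G i c x)"
  using assms(2)
  by (induction I rule: infinite_finite_induct) (auto intro: sepfam_plus sepfam_const assms(1))

text \<open>Three separate classes appear because bounded times bounded has to stay bounded, whereas
  bounded times integrable is merely integrable.\<close>

lemma sepfam_mult:
  assumes F: "sepfam C M \<F> F" and G: "sepfam C M \<G> G"
    and closed: "\<And>f g. f \<in> \<F> \<Longrightarrow> g \<in> \<G> \<Longrightarrow> (\<lambda>x. f x * g x) \<in> \<H>"
  shows "sepfam C M \<H> (\<lambda>c x. F c x * G c x)"
  using F
proof induction
  case F: (scale v f F)
  show ?case using G
  proof induction
    case G: (scale w g G)
    show ?case
    proof (rule sepfam.scale[OF continuous_on_mult[OF F(1) G(1)] closed[OF F(2) G(2)]])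
      show "AE x in M. F c x * G c x = v c * w c * (f x * g x)" if "c \<in> C" for c
        using F(3)[OF that] G(3)[OF that] by eventually_elim simp
    qed
  next
    case G: (add G1 G2 G)
    show ?case
    proof (rule sepfam.add[OF G(4,5)])
      show "AE x in M. F c x * G c x = F c x * G1 c x + F c x * G2 c x" if "c \<in> C" for c
        using G(3)[OF that] by eventually_elim (simp add: distrib_left)
    qed
  qed
next
  case F: (add F1 F2 F)
  show ?case
  proof (rule sepfam.add[OF F(4,5)])
    show "AE x in M. F c x * G c x = F1 c x * G c x + F2 c x * G c x" if "c \<in> C" for c
      using F(3)[OF that] by eventually_elim (simp add: distrib_right)
  qed
qed

lemma sepfam_Linf_mult:
  "sepfam C M (Linf \<Omega>) F \<Longrightarrow> sepfam C M (Linf \<Omega>) G \<Longrightarrow> sepfam C M (Linf \<Omega>) (\<lambda>c x. F c x * G c x)"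
  by (rule sepfam_mult[where \<F> = "Linf \<Omega>" and \<G> = "Linf \<Omega>"]) (auto intro: Linf_mult)

text \<open>The coefficients factor out of the integral, so continuity is that of a finite sum.
  Integrability is carried along in the induction because additivity of the integral depends on
  it.\<close>

lemma sepfam_integral:
  assumes "complete_measure M" and "sepfam C M \<G> G" and "\<G> \<subseteq> {g. integrable M g}"
  shows "(\<forall>c\<in>C. integrable M (G c)) \<and> continuous_on C (\<lambda>c. \<integral>x. G c x \<partial>M)"
proof -
  interpret complete_measure M by fact
  show ?thesis using assms(2)
  proof induction
    case (scale w g G)
    have g: "integrable M g" using scale assms(3) by auto
    have "(\<integral>x. G c x \<partial>M) = w c * (\<integral>x. g x \<partial>M)" if "c \<in> C" for c
      using integral_cong_AE_complete[OF scale(3)[OF that]] by simp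
    moreover have "integrable M (G c)" if "c \<in> C" for c
      using integrable_cong_AE_complete[OF scale(3)[OF that]] g by simp
    ultimately show ?case
      using scale(1) by (auto cong: continuous_on_cong intro!: continuous_intros)
  next
    case (add G1 G2 G)
    have "(\<integral>x. G c x \<partial>M) = (\<integral>x. G1 c x \<partial>M) + (\<integral>x. G2 c x \<partial>M)" if "c \<in> C" for c
      using integral_cong_AE_complete[OF add(3)[OF that]] add that by simp
    moreover have "integrable M (G c)" if "c \<in> C" for c
      using integrable_cong_AE_complete[OF add(3)[OF that]] add that by simp
    ultimately show ?case
      using add by (auto cong: continuous_on_cong intro!: continuous_intros)
  qed
qed

section \<open>Galerkin problems with continuous coefficients\<close>

text \<open>Positivity of the quadratic form makes a diagonal entry a valid pivot for all
  \<open>c\<close> simultaneously. Thus no row exchange depending on \<open>c\<close> occurs, which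
  could break continuity, and each division is by a nowhere vanishing continuous function.\<close>

lemma positive_definite_system_continuous:
  fixes A :: "'i \<Rightarrow> 'i \<Rightarrow> 'c::topological_space \<Rightarrow> real"
  assumes "finite I"
    and "\<And>i j. i \<in> I \<Longrightarrow> j \<in> I \<Longrightarrow> continuous_on C (A i j)"
    and "\<And>i. i \<in> I \<Longrightarrow> continuous_on C (b i)"
    and "\<And>c v. c \<in> C \<Longrightarrow> (\<exists>i\<in>I. v i \<noteq> 0) \<Longrightarrow> (\<Sum>i\<in>I. v i * (\<Sum>j\<in>I. A i j c * v j)) > 0"
  shows "\<exists>x. (\<forall>i\<in>I. continuous_on C (x i)) \<and> (\<forall>c\<in>C. \<forall>i\<in>I. (\<Sum>j\<in>I. A i j c * x j c) = b i c)"
  using assms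
proof (induction I arbitrary: A b rule: finite_induct)
  case empty
  then show ?case by auto
next
  case (insert k I)
  \<comment> \<open>Testing with the unit vector at \<open>k\<close> isolates the diagonal
    entry.\<close>
  have pivot: "A k k c > 0" if "c \<in> C" for c
  proof -
    have "(\<Sum>j\<in>insert k I. A i j c * (if j = k then 1 else 0)) = A i k c" for i
      using insert.hyps by (simp add: if_distrib cong: if_cong)
    then have "(\<Sum>i\<in>insert k I. (if i = k then 1 else 0) * (\<Sum>j\<in>insert k I. A i j c * (if j = k then 1 else 0))) = A k k c"
      using insert.hyps by (simp add: if_distrib if_distribR cong: if_cong)
    with insert.prems(3)[OF that, of "\<lambda>i. if i = k then 1 else 0"] show ?thesis by simp
  qed
  \<comment> \<open>the Schur complement of the pivot; it inherits positivity by completing \<open>v\<close> so that row \<open>k\<close> vanishes\<close>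
  define S where "S i j c = A i j c - A i k c * A k j c / A k k c" for i j c
  define d where "d i c = b i c - A i k c * b k c / A k k c" for i c
  have elim: "(\<Sum>j\<in>I. S i j c * v j) = (\<Sum>j\<in>I. A i j c * v j) - A i k c * (\<Sum>j\<in>I. A k j c * v j) / A k k c"
    for i c v
    by (simp add: S_def left_diff_distrib sum_subtractf sum_distrib_left sum_divide_distrib mult.assoc)
  have "\<exists>x. (\<forall>i\<in>I. continuous_on C (x i)) \<and> (\<forall>c\<in>C. \<forall>i\<in>I. (\<Sum>j\<in>I. S i j c * x j c) = d i c)"
  proof (rule insert.IH)
    show "continuous_on C (S i j)" if "i \<in> I" "j \<in> I" for i j
      unfolding S_def using that pivot insert.prems(1)
      by (intro continuous_intros) (auto simp: less_imp_neq[THEN not_sym])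
    show "continuous_on C (d i)" if "i \<in> I" for i
      unfolding d_def using that pivot insert.prems(1,2)
      by (intro continuous_intros) (auto simp: less_imp_neq[THEN not_sym])
    fix c v assume c: "c \<in> C" and v: "\<exists>i\<in>I. v i \<noteq> (0::real)"
    define w where "w = v(k := - (\<Sum>j\<in>I. A k j c * v j) / A k k c)"
    have [simp]: "(\<Sum>j\<in>I. f j * w j) = (\<Sum>j\<in>I. f j * v j)" for f
      using insert.hyps by (intro sum.cong) (auto simp: w_def)
    have row: "(\<Sum>j\<in>insert k I. A i j c * w j) = (\<Sum>j\<in>I. S i j c * v j)" for i
      using insert.hyps by (simp add: elim) (simp add: w_def)
    \<comment> \<open>The elimination formula also applies to row \<open>k\<close> itself and
      annihilates it, so the \<open>k\<close>-th term of the quadratic form drops out.\<close>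
    have 0: "(\<Sum>j\<in>I. S k j c * v j) = 0"
      using pivot[OF c] by (simp add: elim)
    have "0 < (\<Sum>i\<in>insert k I. w i * (\<Sum>j\<in>insert k I. A i j c * w j))"
      by (rule insert.prems(3)[OF c]) (use v insert.hyps in \<open>auto simp: w_def\<close>)
    also have "\<dots> = (\<Sum>i\<in>I. w i * (\<Sum>j\<in>I. S i j c * v j))"
      unfolding row using insert.hyps 0 by simp
    also have "\<dots> = (\<Sum>i\<in>I. v i * (\<Sum>j\<in>I. S i j c * v j))"
      using insert.hyps by (intro sum.cong) (auto simp: w_def)
    finally show "0 < (\<Sum>i\<in>I. v i * (\<Sum>j\<in>I. S i j c * v j))" .
  qed
  then obtain x where x: "\<And>i. i \<in> I \<Longrightarrow> continuous_on C (x i)"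
    "\<And>c i. c \<in> C \<Longrightarrow> i \<in> I \<Longrightarrow> (\<Sum>j\<in>I. S i j c * x j c) = d i c" by blast
  \<comment> \<open>Back substitution: the equation of row \<open>k\<close> fixes the remaining
    unknown.\<close>
  define y where "y = x(k := (\<lambda>c. (b k c - (\<Sum>j\<in>I. A k j c * x j c)) / A k k c))"
  have [simp]: "(\<Sum>j\<in>I. f j * y j c) = (\<Sum>j\<in>I. f j * x j c)" for f c
    using insert.hyps by (intro sum.cong) (auto simp: y_def)
  show ?case
  proof (intro exI[of _ y] conjI ballI)
    show "continuous_on C (y i)" if "i \<in> insert k I" for i
      using that x(1) insert.prems(1,2) pivot
      by (cases "i = k") (auto simp: y_def less_imp_neq[THEN not_sym] intro!: continuous_intros)
    show "(\<Sum>j\<in>insert k I. A i j c * y j c) = b i c" if c: "c \<in> C" and i: "i \<in> insert k I" for c i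
    proof (cases "i = k")
      case True
      then show ?thesis using insert.hyps pivot[OF c] by simp (simp add: y_def)
    next
      case False
      then have "(\<Sum>j\<in>I. A i j c * x j c) = A i k c * (\<Sum>j\<in>I. A k j c * x j c) / A k k c + d i c"
        using x(2)[OF c, of i] i elim[of i c "\<lambda>j. x j c"] by simp
      then show ?thesis using insert.hyps pivot[OF c]
        by simp (simp add: y_def d_def field_simps)
    qed
  qed
qed

section \<open>Finite-dimensional spaces of functions\<close>

text \<open>Linearity is restricted to members of \<open>V\<close> because the functionals in
  question are integrals, whose additivity rests on integrability against members of
  \<open>V\<close>.\<close>

definition linear_functional_on :: "('a \<Rightarrow> real) set \<Rightarrow> (('a \<Rightarrow> real) \<Rightarrow> real) \<Rightarrow> bool" where
  "linear_functional_on V l \<longleftrightarrow> (\<forall>\<phi>\<in>V. \<forall>\<psi>\<in>V. l (\<lambda>x. \<phi> x + \<psi> x) = l \<phi> + l \<psi>) \<and>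
     (\<forall>k. \<forall>\<phi>\<in>V. l (\<lambda>x. k * \<phi> x) = k * l \<phi>)"

lemma linear_functional_onI:
  "(\<And>\<phi> \<psi>. \<phi> \<in> V \<Longrightarrow> \<psi> \<in> V \<Longrightarrow> l (\<lambda>x. \<phi> x + \<psi> x) = l \<phi> + l \<psi>) \<Longrightarrow>
   (\<And>k \<phi>. \<phi> \<in> V \<Longrightarrow> l (\<lambda>x. k * \<phi> x) = k * l \<phi>) \<Longrightarrow> linear_functional_on V l"
  by (simp add: linear_functional_on_def)

lemma linear_functional_onD:
  assumes "linear_functional_on V l"
  shows "\<phi> \<in> V \<Longrightarrow> \<psi> \<in> V \<Longrightarrow> l (\<lambda>x. \<phi> x + \<psi> x) = l \<phi> + l \<psi>"
    and "\<phi> \<in> V \<Longrightarrow> l (\<lambda>x. k * \<phi> x) = k * l \<phi>"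
  using assms by (simp_all add: linear_functional_on_def)

lemma linear_functional_on_add:
  "linear_functional_on V l \<Longrightarrow> linear_functional_on V l' \<Longrightarrow> linear_functional_on V (\<lambda>\<phi>. l \<phi> + l' \<phi>)"
  by (simp add: linear_functional_on_def distrib_left)

text \<open>Finite dimension is expressed by finitely many points at which a member of
  \<open>V\<close> is determined. For finite elements these are the vertices, and the existence of
  nodal hat functions does not have to be proved: a basis is extracted from the determining set
  instead.\<close>

locale determined_function_space =
  fixes V :: "('a \<Rightarrow> real) set" and X :: "'a set"
  assumes zero: "(\<lambda>_. 0) \<in> V"
    and add: "\<phi> \<in> V \<Longrightarrow> \<psi> \<in> V \<Longrightarrow> (\<lambda>x. \<phi> x + \<psi> x) \<in> V"
    and scale: "\<phi> \<in> V \<Longrightarrow> (\<lambda>x. k * \<phi> x) \<in> V"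
    and finite: "finite X"
    and determined: "\<phi> \<in> V \<Longrightarrow> (\<And>x. x \<in> X \<Longrightarrow> \<phi> x = 0) \<Longrightarrow> \<phi> = (\<lambda>_. 0)"
begin

lemma diff: "\<phi> \<in> V \<Longrightarrow> \<psi> \<in> V \<Longrightarrow> (\<lambda>x. \<phi> x - \<psi> x) \<in> V"
  using add[OF _ scale[of \<psi> "-1"]] by simp

lemma sum: "(\<And>i. i \<in> I \<Longrightarrow> \<phi> i \<in> V) \<Longrightarrow> (\<lambda>x. \<Sum>i\<in>I. w i * \<phi> i x) \<in> V"
  by (induction I rule: infinite_finite_induct) (simp_all add: zero add scale)

lemma linear_functional_sum:
  assumes "linear_functional_on V l" "\<And>i. i \<in> I \<Longrightarrow> \<phi> i \<in> V"
  shows "l (\<lambda>x. \<Sum>i\<in>I. w i * \<phi> i x) = (\<Sum>i\<in>I. w i * l (\<phi> i))"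
proof -
  have 0: "l (\<lambda>_. 0) = 0"
    using linear_functional_onD(2)[OF assms(1) zero, of 0] by simp
  show ?thesis using assms(2)
  proof (induction I rule: infinite_finite_induct)
    case (insert i I)
    have "l (\<lambda>x. w i * \<phi> i x + (\<Sum>i\<in>I. w i * \<phi> i x)) = l (\<lambda>x. w i * \<phi> i x) + l (\<lambda>x. \<Sum>i\<in>I. w i * \<phi> i x)"
      by (rule linear_functional_onD(1)[OF assms(1)]) (intro scale sum insert.prems; simp)+
    moreover have "l (\<lambda>x. w i * \<phi> i x) = w i * l (\<phi> i)"
      by (rule linear_functional_onD(2)[OF assms(1)]) (simp add: insert.prems)
    ultimately show ?case using insert by simp
  qed (simp_all add: 0)
qed

text \<open>A minimal determining set \<open>Z\<close> carries a dual basis: dropping \<open>z\<close> leaves room for a nonzero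
  function vanishing on \<open>Z - {z}\<close>, which cannot vanish at \<open>z\<close>.\<close>

lemma dual_basis:
  obtains Z \<beta> where "finite Z" "\<And>z. z \<in> Z \<Longrightarrow> \<beta> z \<in> V"
    "\<And>y z. y \<in> Z \<Longrightarrow> z \<in> Z \<Longrightarrow> \<beta> z y = (if y = z then 1 else 0)"
    "\<And>\<phi>. \<phi> \<in> V \<Longrightarrow> \<phi> = (\<lambda>x. \<Sum>z\<in>Z. \<phi> z * \<beta> z x)"
proof -
  define det where
    "det Y \<longleftrightarrow> finite Y \<and> (\<forall>\<phi>\<in>V. (\<forall>x\<in>Y. \<phi> x = 0) \<longrightarrow> \<phi> = (\<lambda>_. 0))" for Y
  have "det X" using finite determined unfolding det_def by blast
  then obtain Z where "det Z" and min: "\<And>Y. det Y \<Longrightarrow> card Z \<le> card Y"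
    using ex_has_least_nat[of det X card] by auto
  then have Z: "finite Z" and det: "\<And>\<phi>. \<phi> \<in> V \<Longrightarrow> \<forall>x\<in>Z. \<phi> x = 0 \<Longrightarrow> \<phi> = (\<lambda>_. 0)"
    by (auto simp: det_def)
  have "\<exists>\<psi>\<in>V. \<psi> z = 1 \<and> (\<forall>y\<in>Z - {z}. \<psi> y = 0)" if z: "z \<in> Z" for z
  proof -
    have "card (Z - {z}) < card Z" using card_Diff1_less[OF Z z] .
    then have "\<not> det (Z - {z})" using min[of "Z - {z}"] by linarith
    then obtain \<psi> where \<psi>: "\<psi> \<in> V" "\<forall>y\<in>Z - {z}. \<psi> y = 0" "\<psi> \<noteq> (\<lambda>_. 0)"
      using Z unfolding det_def by blast
    have "\<psi> z \<noteq> 0" using det[OF \<psi>(1)] \<psi>(2,3) by blast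
    then show ?thesis
      using \<psi> scale[OF \<psi>(1), of "1 / \<psi> z"] by (intro bexI[of _ "\<lambda>x. 1 / \<psi> z * \<psi> x"]) simp_all
  qed
  then obtain \<beta> where \<beta>: "\<And>z. z \<in> Z \<Longrightarrow> \<beta> z \<in> V \<and> \<beta> z z = 1 \<and> (\<forall>y\<in>Z - {z}. \<beta> z y = 0)" by metis
  show thesis
  proof (rule that[OF Z, of \<beta>])
    show "\<phi> = (\<lambda>x. \<Sum>z\<in>Z. \<phi> z * \<beta> z x)" if \<phi>: "\<phi> \<in> V" for \<phi>
    proof -
      have "(\<lambda>x. \<phi> x - (\<Sum>z\<in>Z. \<phi> z * \<beta> z x)) = (\<lambda>_. 0)"
      proof (rule det)
        show "(\<lambda>x. \<phi> x - (\<Sum>z\<in>Z. \<phi> z * \<beta> z x)) \<in> V" using \<phi> \<beta> by (intro diff sum) auto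
        show "\<forall>y\<in>Z. \<phi> y - (\<Sum>z\<in>Z. \<phi> z * \<beta> z y) = 0"
        proof
          fix y assume y: "y \<in> Z"
          have "(\<Sum>z\<in>Z. \<phi> z * \<beta> z y) = (\<Sum>z\<in>Z. if y = z then \<phi> y else 0)"
            using \<beta> y by (intro sum.cong) auto
          then show "\<phi> y - (\<Sum>z\<in>Z. \<phi> z * \<beta> z y) = 0" using y Z by simp
        qed
      qed
      from fun_cong[OF this] show ?thesis by (intro ext) (rule eq_iff_diff_eq_0[THEN iffD2])
    qed
  qed (use \<beta> in auto)
qed

text \<open>Coordinates with respect to a dual basis are point values, so pointwise continuity
  amounts to continuity of all coordinates.\<close>

definition continuous_family :: "'c::topological_space set \<Rightarrow> ('c \<Rightarrow> 'a \<Rightarrow> real) \<Rightarrow> bool" where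
  "continuous_family C q \<longleftrightarrow> (\<forall>c\<in>C. q c \<in> V) \<and> (\<forall>x. continuous_on C (\<lambda>c. q c x))"

lemma continuous_family_const: "\<phi> \<in> V \<Longrightarrow> continuous_family C (\<lambda>_. \<phi>)"
  by (simp add: continuous_family_def)

lemma continuous_family_add:
  "continuous_family C p \<Longrightarrow> continuous_family C q \<Longrightarrow> continuous_family C (\<lambda>c x. p c x + q c x)"
  by (auto simp: continuous_family_def intro!: add continuous_intros)

lemma continuous_family_scale: "continuous_family C p \<Longrightarrow> continuous_family C (\<lambda>c x. k * p c x)"
  by (auto simp: continuous_family_def intro!: scale continuous_intros)

text \<open>The difference of two solutions is tested with itself. Writing it as a sum with a
  multiple by \<open>-1\<close> matches the closure rules of \<open>V\<close> and the two linearity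
  rules.\<close>

lemma galerkin_unique:
  assumes bil: "\<And>\<psi>. \<psi> \<in> V \<Longrightarrow> linear_functional_on V (\<lambda>\<phi>. B \<phi> \<psi>)"
    and pos: "\<And>\<phi>. \<phi> \<in> V \<Longrightarrow> \<phi> \<noteq> (\<lambda>_. 0) \<Longrightarrow> B \<phi> \<phi> > 0"
    and p: "p \<in> V" and q: "q \<in> V" and eq: "\<And>\<psi>. \<psi> \<in> V \<Longrightarrow> B p \<psi> = B q \<psi>"
  shows "p = q"
proof (rule ccontr)
  let ?d = "\<lambda>x. p x + (-1) * q x"
  assume "p \<noteq> q"
  then have "?d \<noteq> (\<lambda>_. 0)" by (auto simp: fun_eq_iff)
  moreover have d: "?d \<in> V" by (intro add scale p q)
  ultimately have "B ?d ?d > 0" by (rule pos[rotated])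
  moreover have "B ?d \<psi> = B p \<psi> + B (\<lambda>x. (-1) * q x) \<psi>" if "\<psi> \<in> V" for \<psi>
    by (rule linear_functional_onD(1)[OF bil[OF that] p scale[OF q]])
  moreover have "B (\<lambda>x. (-1) * q x) \<psi> = (-1) * B q \<psi>" if "\<psi> \<in> V" for \<psi>
    by (rule linear_functional_onD(2)[OF bil[OF that] q])
  ultimately show False using eq[OF d] d by simp
qed

text \<open>In dual coordinates the problem is a linear system with entries
  \<open>B c (\<beta> j) (\<beta> i)\<close>, whose rows \<open>i\<close> belong to the test
  functions. Continuity of the entries and positivity of the form are what the elimination lemma
  asks for.\<close>

lemma galerkin_continuous:
  assumes bil: "\<And>c \<psi>. c \<in> C \<Longrightarrow> \<psi> \<in> V \<Longrightarrow> linear_functional_on V (\<lambda>\<phi>. B c \<phi> \<psi>)"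
    and bir: "\<And>c \<phi>. c \<in> C \<Longrightarrow> \<phi> \<in> V \<Longrightarrow> linear_functional_on V (B c \<phi>)"
    and pos: "\<And>c \<phi>. c \<in> C \<Longrightarrow> \<phi> \<in> V \<Longrightarrow> \<phi> \<noteq> (\<lambda>_. 0) \<Longrightarrow> B c \<phi> \<phi> > 0"
    and lin: "\<And>c. c \<in> C \<Longrightarrow> linear_functional_on V (l c)"
    and contB: "\<And>\<phi> \<psi>. \<phi> \<in> V \<Longrightarrow> \<psi> \<in> V \<Longrightarrow> continuous_on C (\<lambda>c. B c \<phi> \<psi>)"
    and contl: "\<And>\<psi>. \<psi> \<in> V \<Longrightarrow> continuous_on C (\<lambda>c. l c \<psi>)"
  shows "\<exists>q. continuous_family C q \<and> (\<forall>c\<in>C. \<forall>\<psi>\<in>V. B c (q c) \<psi> = l c \<psi>)"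
proof -
  obtain Z \<beta> where Z: "finite Z" and \<beta>: "\<And>z. z \<in> Z \<Longrightarrow> \<beta> z \<in> V"
    and dual: "\<And>y z. y \<in> Z \<Longrightarrow> z \<in> Z \<Longrightarrow> \<beta> z y = (if y = z then 1 else 0)"
    and expand: "\<And>\<phi>. \<phi> \<in> V \<Longrightarrow> \<phi> = (\<lambda>x. \<Sum>z\<in>Z. \<phi> z * \<beta> z x)"
    by (rule dual_basis) blast
  have Bsum: "B c (\<lambda>x. \<Sum>z\<in>Z. v z * \<beta> z x) \<psi> = (\<Sum>z\<in>Z. B c (\<beta> z) \<psi> * v z)" if "c \<in> C" "\<psi> \<in> V" for c v \<psi>
    using linear_functional_sum[OF bil[OF that], of Z \<beta> v] \<beta> by (simp add: mult.commute)
  have "\<exists>x. (\<forall>i\<in>Z. continuous_on C (x i)) \<and> (\<forall>c\<in>C. \<forall>i\<in>Z. (\<Sum>j\<in>Z. B c (\<beta> j) (\<beta> i) * x j c) = l c (\<beta> i))"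
  proof (rule positive_definite_system_continuous[OF Z])
    fix c v assume c: "c \<in> C" and v: "\<exists>i\<in>Z. v i \<noteq> (0::real)"
    let ?\<phi> = "\<lambda>x. \<Sum>z\<in>Z. v z * \<beta> z x"
    have \<phi>: "?\<phi> \<in> V" using \<beta> by (rule sum)
    obtain y where y: "y \<in> Z" "v y \<noteq> 0" using v by blast
    \<comment> \<open>Evaluation at \<open>y\<close> recovers the coefficient \<open>v y\<close>, so
      the combination is not the zero function.\<close>
    have "?\<phi> y = (\<Sum>z\<in>Z. if y = z then v y else 0)" using dual y by (intro sum.cong) auto
    then have "?\<phi> y \<noteq> 0" using y Z by simp
    then have "?\<phi> \<noteq> (\<lambda>_. 0)" by metis
    then have "0 < B c ?\<phi> ?\<phi>" by (rule pos[OF c \<phi>])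
    also have "\<dots> = (\<Sum>i\<in>Z. v i * B c ?\<phi> (\<beta> i))"
      by (rule linear_functional_sum[OF bir[OF c \<phi>] \<beta>])
    also have "\<dots> = (\<Sum>i\<in>Z. v i * (\<Sum>j\<in>Z. B c (\<beta> j) (\<beta> i) * v j))"
      using Bsum[OF c] \<beta> by simp
    finally show "0 < (\<Sum>i\<in>Z. v i * (\<Sum>j\<in>Z. B c (\<beta> j) (\<beta> i) * v j))" .
  qed (use contB contl \<beta> in auto)
  then obtain x where x: "\<And>i. i \<in> Z \<Longrightarrow> continuous_on C (x i)"
    "\<And>c i. c \<in> C \<Longrightarrow> i \<in> Z \<Longrightarrow> (\<Sum>j\<in>Z. B c (\<beta> j) (\<beta> i) * x j c) = l c (\<beta> i)" by blast
  let ?q = "\<lambda>c y. \<Sum>z\<in>Z. x z c * \<beta> z y"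
  have "B c (?q c) \<psi> = l c \<psi>" if c: "c \<in> C" and \<psi>: "\<psi> \<in> V" for c \<psi>
  proof -
    have q: "?q c \<in> V" using \<beta> by (rule sum)
    have "B c (?q c) (\<lambda>x. \<Sum>z\<in>Z. \<psi> z * \<beta> z x) = (\<Sum>z\<in>Z. \<psi> z * B c (?q c) (\<beta> z))"
      by (rule linear_functional_sum[OF bir[OF c q] \<beta>])
    also have "\<dots> = (\<Sum>z\<in>Z. \<psi> z * l c (\<beta> z))"
      using Bsum[OF c \<beta>] x(2)[OF c] by simp
    also have "\<dots> = l c (\<lambda>x. \<Sum>z\<in>Z. \<psi> z * \<beta> z x)"
      by (rule linear_functional_sum[OF lin[OF c] \<beta>, symmetric])
    finally show ?thesis using expand[OF \<psi>] by simp
  qed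
  moreover have "continuous_family C ?q"
    unfolding continuous_family_def using \<beta> x(1) by (auto intro!: sum continuous_intros)
  ultimately show ?thesis by blast
qed

end

section \<open>The finite element space\<close>

lemma gradient_eqI:
  assumes "GDERIV v x :> D" shows "gradient v x = D"
  unfolding gradient_def
proof (rule the_equality[where P = "\<lambda>D. GDERIV v x :> D", OF assms])
  fix D' assume "GDERIV v x :> D'"
  with assms have "(\<lambda>h. h \<bullet> D') = (\<lambda>h. h \<bullet> D)"
    unfolding gderiv_def by (rule has_derivative_unique[rotated])
  then show "D' = D" by (simp add: fun_eq_iff vector_eq_ldot)
qed

text \<open>Connectedness of \<open>\<Omega>\<close> and a point of \<open>\<Gamma>D\<close> make
  the stiffness form definite; full dimension gives every element an interior point in
  \<open>\<Omega>\<close>.\<close>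

locale finite_element_mesh =
  fixes \<Omega> \<Gamma>D :: "'a::euclidean_space set" and \<T> :: "'a set set"
  assumes \<Omega>: "open \<Omega>" "connected \<Omega>" "bounded \<Omega>"
    and \<Gamma>D: "\<Gamma>D \<noteq> {}" "\<Gamma>D \<subseteq> frontier \<Omega>"
    and triangulation: "triangulation \<T>"
    and cell_simplex: "K \<in> \<T> \<Longrightarrow> int DIM('a) simplex K"
    and covers: "\<Union>\<T> = closure \<Omega>"
begin

abbreviation "V \<equiv> P1_D \<Omega> \<Gamma>D \<T>"

lemma lmeasurable_\<Omega>: "\<Omega> \<in> lmeasurable"
  using \<Omega> by (simp add: lmeasurable_open)

sublocale M: complete_measure "lebesgue_on \<Omega>"
  using lmeasurable_\<Omega> by (intro complete_measure_lebesgue_on) (simp add: fmeasurable_def)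

sublocale M: finite_measure "lebesgue_on \<Omega>"
  by (rule finite_measure_lebesgue_on[OF lmeasurable_\<Omega>])

lemma finite_\<T>: "finite \<T>"
  using triangulation by (simp add: triangulation_def)

lemma cell_subset: "K \<in> \<T> \<Longrightarrow> K \<subseteq> closure \<Omega>"
  using covers by blast

lemma cell_convex: "K \<in> \<T> \<Longrightarrow> convex K" and cell_compact: "K \<in> \<T> \<Longrightarrow> compact K"
  using cell_simplex by (auto dest: convex_simplex compact_simplex)

section \<open>Elements and the skeleton\<close>

text \<open>The interior is a nonempty open subset of \<open>closure \<Omega>\<close> and therefore
  meets \<open>\<Omega>\<close>. This transports statements known only on \<open>\<Omega>\<close>,
  such as the bounds in \<open>V_ad\<close>, to the constant value on an element.\<close>

lemma cell_interior_nonempty: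
  assumes "K \<in> \<T>" shows "interior K \<inter> \<Omega> \<noteq> {}"
proof -
  have "aff_dim K = int DIM('a)" using cell_simplex[OF assms] by (rule aff_dim_simplex)
  then have "interior K \<noteq> {}"
    using cell_convex[OF assms] rel_interior_eq_empty[of K] rel_interior_interior[of K]
    by (auto simp: aff_dim_eq_full)
  moreover have "interior K \<subseteq> closure \<Omega>" using interior_subset cell_subset[OF assms] by blast
  ultimately show ?thesis using open_Int_closure_eq_empty[OF open_interior[of K], of \<Omega>] by blast
qed

text \<open>The intersection is a face of both elements, and a face that meets the interior of a
  convex set is the whole set.\<close>

lemma cell_unique:
  assumes "K \<in> \<T>" "L \<in> \<T>" "x \<in> interior K" "x \<in> interior L"
  shows "K = L"
proof -
  have "K \<inter> L face_of K" "L \<inter> K face_of L" using triangulation assms by (auto simp: triangulation_def)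
  moreover have "x \<in> K \<inter> L" using assms interior_subset by blast
  ultimately have "K \<inter> L = K" "L \<inter> K = L"
    using face_of_disjoint_interior[of "K \<inter> L" K] face_of_disjoint_interior[of "L \<inter> K" L] assms by blast+
  then show ?thesis by blast
qed

lemma AE_cell: "AE x in lebesgue_on \<Omega>. \<exists>K\<in>\<T>. x \<in> interior K"
proof -
  have "negligible (\<Union>K\<in>\<T>. frontier K)"
    using finite_\<T> cell_convex by (intro negligible_Union) (auto intro: negligible_convex_frontier)
  then have "AE x in lebesgue. x \<notin> (\<Union>K\<in>\<T>. frontier K)"
    by (intro AE_not_in) (simp add: negligible_iff_null_sets)
  then have "AE x in lebesgue. x \<in> \<Omega> \<longrightarrow> (\<exists>K\<in>\<T>. x \<in> interior K)"
  proof eventually_elim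
    case (elim x)
    show ?case
    proof
      assume "x \<in> \<Omega>"
      then obtain K where "K \<in> \<T>" "x \<in> K" using covers closure_subset by blast
      with elim show "\<exists>K\<in>\<T>. x \<in> interior K" using closure_subset unfolding frontier_def by blast
    qed
  qed
  then show ?thesis using lmeasurable_\<Omega> by (subst AE_restrict_space_iff) (auto simp: fmeasurable_def)
qed

lemma AE_cellI:
  assumes "\<And>K x. K \<in> \<T> \<Longrightarrow> x \<in> interior K \<Longrightarrow> P x"
  shows "AE x in lebesgue_on \<Omega>. P x"
  using AE_cell by eventually_elim (use assms in blast)

text \<open>Nonempty open sets are not negligible. This turns almost everywhere information into
  information at a point, which is enough for a continuous function or for a constant
  gradient.\<close>

lemma AE_open_point:
  assumes "AE x in lebesgue_on \<Omega>. P x" "open W" "W \<inter> \<Omega> \<noteq> {}"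
  obtains x where "x \<in> W \<inter> \<Omega>" "P x"
proof -
  have "AE x in lebesgue. x \<in> \<Omega> \<longrightarrow> P x"
    using assms(1) lmeasurable_\<Omega> by (subst (asm) AE_restrict_space_iff) (auto simp: fmeasurable_def)
  then obtain N where N: "N \<in> null_sets lebesgue" "{x. \<not> (x \<in> \<Omega> \<longrightarrow> P x)} \<subseteq> N"
    by (force elim!: AE_E3)
  have "\<not> negligible (W \<inter> \<Omega>)" using assms \<Omega> by (intro open_not_negligible) auto
  then have "\<not> W \<inter> \<Omega> \<subseteq> N" using N(1) negligible_subset by (auto simp: negligible_iff_null_sets)
  then show thesis using that N(2) by blast
qed

lemma cell_sum:
  fixes w :: "'a set \<Rightarrow> real"
  assumes "K \<in> \<T>" "x \<in> interior K"
  shows "(\<Sum>L\<in>\<T>. w L * indicator (interior L) x) = w K"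
proof -
  have "(\<Sum>L\<in>\<T>. w L * indicator (interior L) x) = (\<Sum>L\<in>\<T>. if L = K then w K else 0)"
  proof (intro sum.cong refl)
    fix L assume "L \<in> \<T>"
    then have "x \<notin> interior L" if "L \<noteq> K" using cell_unique[of L K x] assms that by blast
    then show "w L * indicator (interior L) x = (if L = K then w K else 0)"
      using assms(2) by (cases "L = K") simp_all
  qed
  then show ?thesis using finite_\<T> assms(1) by simp
qed

lemma indicator_cell_Linf: "indicator (interior K) \<in> Linf \<Omega>"
  unfolding Linf_iff
proof
  show "indicator (interior K) \<in> borel_measurable (lebesgue_on \<Omega>)"
    by (intro measurable_restrict_space1 borel_measurable_indicator) simp
  show "\<exists>B. AE x in lebesgue_on \<Omega>. \<bar>indicator (interior K) x\<bar> \<le> (B::real)"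
    by (intro exI[of _ 1] AE_I2) (simp add: indicator_def)
qed

lemma Linf_cong_AE:
  assumes "v \<in> Linf \<Omega>" and eq: "AE x in lebesgue_on \<Omega>. w x = v x"
  shows "w \<in> Linf \<Omega>"
proof -
  obtain B where "AE x in lebesgue_on \<Omega>. \<bar>v x\<bar> \<le> B" using assms by (auto simp: Linf_iff)
  with eq have "AE x in lebesgue_on \<Omega>. \<bar>w x\<bar> \<le> B" by eventually_elim simp
  then show ?thesis using M.borel_measurable_cong_AE[OF eq] assms(1) unfolding Linf_iff by blast
qed

text \<open>The values of \<open>v\<close> on the skeleton are arbitrary; completeness of the
  measure still makes \<open>v\<close> measurable.\<close>

lemma cellwise_constant_Linf:
  assumes "\<And>K x. K \<in> \<T> \<Longrightarrow> x \<in> interior K \<Longrightarrow> v x = w K"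
  shows "v \<in> Linf \<Omega>"
proof (rule Linf_cong_AE)
  show "(\<lambda>x. \<Sum>L\<in>\<T>. w L * indicator (interior L) x) \<in> Linf \<Omega>"
    by (intro Linf_sum Linf_cmult indicator_cell_Linf)
  show "AE x in lebesgue_on \<Omega>. v x = (\<Sum>L\<in>\<T>. w L * indicator (interior L) x)"
    by (rule AE_cellI) (simp add: cell_sum assms)
qed

section \<open>Piecewise affine functions\<close>

lemma P1_affine:
  assumes "\<phi> \<in> P1 \<Omega> \<T>" "K \<in> \<T>"
  obtains a c where "\<And>x. x \<in> K \<Longrightarrow> \<phi> x = a \<bullet> x + c" "\<And>x. x \<in> interior K \<Longrightarrow> GDERIV \<phi> x :> a"
proof -
  obtain a c where eq: "\<And>x. x \<in> K \<Longrightarrow> \<phi> x = a \<bullet> x + c" using assms by (auto simp: P1_def)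
  have "GDERIV \<phi> x :> a" if "x \<in> interior K" for x
    unfolding gderiv_def
  proof (rule has_derivative_transform_within_open[of "\<lambda>x. a \<bullet> x + c"])
    show "FDERIV (\<lambda>x. a \<bullet> x + c) x :> (\<lambda>h. h \<bullet> a)"
      by (auto intro!: derivative_eq_intros simp: inner_commute)
    show "a \<bullet> y + c = \<phi> y" if "y \<in> interior K" for y
      using eq interior_subset that by (metis in_mono)
  qed (use that in auto)
  with eq show thesis by (rule that)
qed

lemma P1_GDERIV:
  assumes "\<phi> \<in> P1 \<Omega> \<T>" "K \<in> \<T>" "x \<in> interior K"
  shows "GDERIV \<phi> x :> gradient \<phi> x"
  using P1_affine[OF assms(1,2)] gradient_eqI assms(3) by metis

lemma P1_gradient_DG0: "\<phi> \<in> P1 \<Omega> \<T> \<Longrightarrow> gradient \<phi> \<in> DG0 \<T>"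
  unfolding DG0_def constant_on_def using P1_affine gradient_eqI by (smt (verit) mem_Collect_eq)

lemma V_P1: "\<phi> \<in> V \<Longrightarrow> \<phi> \<in> P1 \<Omega> \<T>"
  by (simp add: P1_D_def)

lemma gradient_add:
  "\<phi> \<in> V \<Longrightarrow> \<psi> \<in> V \<Longrightarrow> K \<in> \<T> \<Longrightarrow> x \<in> interior K \<Longrightarrow>
    gradient (\<lambda>x. \<phi> x + \<psi> x) x = gradient \<phi> x + gradient \<psi> x"
  by (intro gradient_eqI GDERIV_add P1_GDERIV[OF V_P1])

lemma gradient_scale:
  "\<phi> \<in> V \<Longrightarrow> K \<in> \<T> \<Longrightarrow> x \<in> interior K \<Longrightarrow> gradient (\<lambda>x. k * \<phi> x) x = k *\<^sub>R gradient \<phi> x"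
  using GDERIV_mult[OF GDERIV_const P1_GDERIV[OF V_P1], of \<phi> K x k] by (intro gradient_eqI) simp

text \<open>Vertices on \<open>\<Gamma>D\<close> are included: only a finite determining set is
  wanted here, and the actual degrees of freedom are selected by \<open>dual_basis\<close>.\<close>

definition "nodes = (\<Union>K\<in>\<T>. {x. x extreme_point_of K})"

lemma V_I:
  assumes "continuous_on (closure \<Omega>) \<phi>" and "\<And>K. K \<in> \<T> \<Longrightarrow> \<exists>a c. \<forall>x\<in>K. \<phi> x = a \<bullet> x + c"
    and "\<And>x. x \<notin> closure \<Omega> \<Longrightarrow> \<phi> x = 0" and "\<And>x. x \<in> \<Gamma>D \<Longrightarrow> \<phi> x = 0"
  shows "\<phi> \<in> V"
  using assms by (simp add: P1_D_def P1_def)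

lemma V_continuous: "\<phi> \<in> V \<Longrightarrow> continuous_on (closure \<Omega>) \<phi>"
  and V_outside: "\<phi> \<in> V \<Longrightarrow> x \<notin> closure \<Omega> \<Longrightarrow> \<phi> x = 0"
  and V_boundary: "\<phi> \<in> V \<Longrightarrow> x \<in> \<Gamma>D \<Longrightarrow> \<phi> x = 0"
  by (simp_all add: P1_D_def P1_def)

lemma V_affine: "\<phi> \<in> V \<Longrightarrow> K \<in> \<T> \<Longrightarrow> \<exists>a c. \<forall>x\<in>K. \<phi> x = a \<bullet> x + c"
  by (simp add: P1_D_def P1_def)

sublocale V: determined_function_space V nodes
proof
  show "(\<lambda>_. 0) \<in> V"
  proof (rule V_I)
    show "\<exists>a c. \<forall>x\<in>K. 0 = a \<bullet> x + c" for K :: "'a set" by (intro exI[of _ 0]) simp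
  qed simp_all
next
  fix \<phi> \<psi> assume V: "\<phi> \<in> V" "\<psi> \<in> V"
  show "(\<lambda>x. \<phi> x + \<psi> x) \<in> V"
  proof (rule V_I)
    fix K assume K: "K \<in> \<T>"
    obtain a c where 1: "\<forall>x\<in>K. \<phi> x = a \<bullet> x + c" using V_affine[OF V(1) K] by blast
    obtain b d where 2: "\<forall>x\<in>K. \<psi> x = b \<bullet> x + d" using V_affine[OF V(2) K] by blast
    show "\<exists>a c. \<forall>x\<in>K. \<phi> x + \<psi> x = a \<bullet> x + c"
      by (intro exI[of _ "a + b"] exI[of _ "c + d"]) (simp add: 1 2 inner_add_left)
  qed (use V in \<open>simp_all add: V_outside V_boundary continuous_on_add V_continuous\<close>)
next
  fix \<phi> k assume V: "\<phi> \<in> V"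
  show "(\<lambda>x. k * \<phi> x) \<in> V"
  proof (rule V_I)
    fix K assume K: "K \<in> \<T>"
    obtain a c where 1: "\<forall>x\<in>K. \<phi> x = a \<bullet> x + c" using V_affine[OF V K] by blast
    show "\<exists>a c. \<forall>x\<in>K. k * \<phi> x = a \<bullet> x + c"
      by (intro exI[of _ "k *\<^sub>R a"] exI[of _ "k * c"]) (simp add: 1 distrib_left)
  qed (use V in \<open>simp_all add: V_outside V_boundary continuous_on_mult_left V_continuous\<close>)
next
  show "finite nodes"
    unfolding nodes_def
  proof (intro finite_UN_I finite_\<T>)
    fix K assume "K \<in> \<T>"
    then obtain C where "finite C" "K = convex hull C" using cell_simplex by (auto simp: simplex)
    then show "finite {x. x extreme_point_of K}"
      using extreme_points_of_convex_hull finite_subset by metis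
  qed
next
  fix \<phi> assume \<phi>: "\<phi> \<in> V" and 0: "\<And>x. x \<in> nodes \<Longrightarrow> \<phi> x = 0"
  have "\<phi> x = 0" if "K \<in> \<T>" "x \<in> K" for K x
  proof -
    obtain a c where ac: "\<forall>x\<in>K. \<phi> x = a \<bullet> x + c" using V_affine[OF \<phi> \<open>K \<in> \<T>\<close>] by blast
    let ?E = "{x. x extreme_point_of K}"
    have "?E \<subseteq> {x. a \<bullet> x = - c}"
    proof safe
      fix x assume x: "x extreme_point_of K"
      then have "x \<in> K" "x \<in> nodes" using that(1) by (auto simp: nodes_def extreme_point_of_def)
      then have "a \<bullet> x + c = 0" using ac 0 by metis
      then show "a \<bullet> x = - c" by simp
    qed
    \<comment> \<open>The zero set of an affine function is convex, so it contains the hull of the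
      vertices, which is all of \<open>K\<close> by Krein-Milman.\<close>
    then have "convex hull ?E \<subseteq> {x. a \<bullet> x = - c}" by (intro hull_minimal convex_hyperplane)
    moreover have "K = convex hull ?E"
      by (intro Krein_Milman_Minkowski cell_compact cell_convex that(1))
    ultimately show ?thesis using ac that(2) by auto
  qed
  moreover have "\<phi> x = 0" if "x \<notin> closure \<Omega>" for x using that by (rule V_outside[OF \<phi>])
  ultimately show "\<phi> = (\<lambda>_. 0)" using covers by (metis UnionE)
qed

lemma V_Linf: assumes "\<phi> \<in> V" shows "\<phi> \<in> Linf \<Omega>"
proof -
  have "compact (\<phi> ` closure \<Omega>)"
    using \<Omega> by (intro compact_continuous_image V_continuous assms) (simp add: compact_closure)
  then obtain B where "\<And>x. x \<in> closure \<Omega> \<Longrightarrow> \<bar>\<phi> x\<bar> \<le> B"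
    by (metis bounded_real compact_imp_bounded imageI)
  then have "AE x in lebesgue_on \<Omega>. \<bar>\<phi> x\<bar> \<le> B"
    using closure_subset by (intro AE_I2) (auto simp: space_restrict_space)
  moreover have "\<phi> \<in> borel_measurable (lebesgue_on \<Omega>)"
    using continuous_on_subset[OF V_continuous[OF assms] closure_subset] \<Omega>(1)
    by (intro continuous_imp_measurable_on_sets_lebesgue) auto
  ultimately show ?thesis unfolding Linf_iff by blast
qed

lemma DG0_component_Linf:
  assumes "u \<in> DG0 \<T>" shows "(\<lambda>x. u x \<bullet> b) \<in> Linf \<Omega>"
proof -
  obtain A where "\<And>K x. K \<in> \<T> \<Longrightarrow> x \<in> interior K \<Longrightarrow> u x = A K"
    using assms unfolding DG0_def constant_on_def by simp metis
  then show ?thesis by (intro cellwise_constant_Linf[of _ "\<lambda>K. A K \<bullet> b"]) simp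
qed

lemma gradient_Linf: "\<phi> \<in> V \<Longrightarrow> (\<lambda>x. gradient \<phi> x \<bullet> b) \<in> Linf \<Omega>"
  by (intro DG0_component_Linf P1_gradient_DG0 V_P1)

lemma integrable_inner_gradient:
  assumes "u \<in> DG0 \<T>" "\<phi> \<in> V"
  shows "integrable (lebesgue_on \<Omega>) (\<lambda>x. u x \<bullet> gradient \<phi> x)"
proof -
  have "integrable (lebesgue_on \<Omega>) (\<lambda>x. \<Sum>b\<in>Basis. (u x \<bullet> b) * (gradient \<phi> x \<bullet> b))"
    by (intro Linf_integrable lmeasurable_\<Omega> Linf_sum Linf_mult gradient_Linf DG0_component_Linf assms)
  then show ?thesis by (subst euclidean_inner)
qed

lemma gradient_sum:
  assumes "\<And>i. i \<in> I \<Longrightarrow> \<phi> i \<in> V" "K \<in> \<T>" "x \<in> interior K"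
  shows "gradient (\<lambda>x. \<Sum>i\<in>I. w i * \<phi> i x) x = (\<Sum>i\<in>I. w i *\<^sub>R gradient (\<phi> i) x)"
proof -
  have "GDERIV (\<lambda>x. \<Sum>i\<in>I. w i * \<phi> i x) x :> (\<Sum>i\<in>I. w i *\<^sub>R gradient (\<phi> i) x)"
    using assms(1)
  proof (induction I rule: infinite_finite_induct)
    case (insert i I)
    have "GDERIV (\<lambda>x. w i * \<phi> i x) x :> w i *\<^sub>R gradient (\<phi> i) x"
      using P1_GDERIV[OF V_P1[OF V.scale[of "\<phi> i" "w i"]] assms(2,3)] gradient_scale[OF _ assms(2,3)] insert.prems
      by simp
    then show ?case using insert by (simp add: GDERIV_add)
  qed (simp_all add: GDERIV_const)
  then show ?thesis by (rule gradient_eqI)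
qed

text \<open>The dual basis expansion separates the variables, with the continuous point values
  \<open>q c z\<close> as coefficients. For gradients it holds only inside the elements, hence
  almost everywhere.\<close>

lemma sepfam_V:
  assumes q: "V.continuous_family C q"
  shows "sepfam C (lebesgue_on \<Omega>) (Linf \<Omega>) q"
    and "sepfam C (lebesgue_on \<Omega>) (Linf \<Omega>) (\<lambda>c x. gradient (q c) x \<bullet> b)"
proof -
  obtain Z \<beta> where Z: "finite Z" and \<beta>: "\<And>z. z \<in> Z \<Longrightarrow> \<beta> z \<in> V"
    and expand: "\<And>\<phi>. \<phi> \<in> V \<Longrightarrow> \<phi> = (\<lambda>x. \<Sum>z\<in>Z. \<phi> z * \<beta> z x)"
    by (rule V.dual_basis) blast
  have qV: "q c \<in> V" if "c \<in> C" for c using q that by (simp add: V.continuous_family_def)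
  have qc: "continuous_on C (\<lambda>c. q c z)" for z using q by (simp add: V.continuous_family_def)
  show "sepfam C (lebesgue_on \<Omega>) (Linf \<Omega>) q"
  proof (rule sepfam_cong)
    show "sepfam C (lebesgue_on \<Omega>) (Linf \<Omega>) (\<lambda>c x. \<Sum>z\<in>Z. q c z * \<beta> z x)"
      by (intro sepfam_sum sepfam_cmult sepfam_const qc V_Linf \<beta> Linf_const)
    show "AE x in lebesgue_on \<Omega>. q c x = (\<Sum>z\<in>Z. q c z * \<beta> z x)" if "c \<in> C" for c
      using fun_cong[OF expand[OF qV[OF that]]] by (intro AE_I2)
  qed
  show "sepfam C (lebesgue_on \<Omega>) (Linf \<Omega>) (\<lambda>c x. gradient (q c) x \<bullet> b)"
  proof (rule sepfam_cong)
    show "sepfam C (lebesgue_on \<Omega>) (Linf \<Omega>) (\<lambda>c x. \<Sum>z\<in>Z. q c z * (gradient (\<beta> z) x \<bullet> b))"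
      by (intro sepfam_sum sepfam_cmult sepfam_const qc gradient_Linf \<beta> Linf_const)
    show "AE x in lebesgue_on \<Omega>. gradient (q c) x \<bullet> b = (\<Sum>z\<in>Z. q c z * (gradient (\<beta> z) x \<bullet> b))"
      if "c \<in> C" for c
    proof (rule AE_cellI)
      fix K x assume "K \<in> \<T>" "x \<in> interior K"
      from gradient_sum[of Z \<beta>, OF _ this, where w = "q c"] \<beta> expand[OF qV[OF that], symmetric]
      show "gradient (q c) x \<bullet> b = (\<Sum>z\<in>Z. q c z * (gradient (\<beta> z) x \<bullet> b))"
        by (simp add: inner_sum_left)
    qed
  qed
qed

section \<open>Definiteness of the mass and stiffness forms\<close>

text \<open>A vanishing integral forces \<open>\<phi>\<close> to vanish almost everywhere.
  Continuity extends this to \<open>\<Omega>\<close> and its closure; outside, members of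
  \<open>P1\<close> are zero by normalisation.\<close>

lemma mass_positive:
  assumes w: "w \<in> Linf \<Omega>" and k: "k > 0" "AE x in lebesgue_on \<Omega>. k \<le> w x"
    and \<phi>: "\<phi> \<in> V" "\<phi> \<noteq> (\<lambda>_. 0)"
  shows "(\<integral>x. w x * \<phi> x * \<phi> x \<partial>lebesgue_on \<Omega>) > 0"
proof (rule ccontr)
  let ?g = "\<lambda>x. w x * \<phi> x * \<phi> x"
  have int: "integrable (lebesgue_on \<Omega>) ?g"
    by (intro Linf_integrable lmeasurable_\<Omega> Linf_mult w V_Linf \<phi>)
  have nn: "AE x in lebesgue_on \<Omega>. 0 \<le> ?g x"
    using k(2) by eventually_elim (use k(1) in \<open>simp add: mult.assoc\<close>)
  assume "\<not> ?thesis"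
  then have "(\<integral>x. ?g x \<partial>lebesgue_on \<Omega>) = 0"
    using integral_nonneg_AE[OF nn] by linarith
  then have "AE x in lebesgue_on \<Omega>. ?g x = 0"
    using integral_nonneg_eq_0_iff_AE[OF int nn] by blast
  then have ae: "AE x in lebesgue_on \<Omega>. \<phi> x = 0"
    using k(2) by eventually_elim (use k(1) in auto)
  have "\<phi> x = 0" if "x \<in> \<Omega>" for x
  proof (rule ccontr)
    assume "\<phi> x \<noteq> 0"
    have "continuous_on \<Omega> \<phi>" using V_continuous[OF \<phi>(1)] closure_subset continuous_on_subset by blast
    then have W: "open (\<Omega> \<inter> \<phi> -` (- {0}))" using \<Omega>(1) by (intro continuous_open_preimage) auto
    have "x \<in> \<Omega> \<inter> \<phi> -` (- {0}) \<inter> \<Omega>" using that \<open>\<phi> x \<noteq> 0\<close> by simp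
    then obtain y where "y \<in> \<Omega> \<inter> \<phi> -` (- {0}) \<inter> \<Omega>" "\<phi> y = 0" using AE_open_point[OF ae W] by blast
    then show False by auto
  qed
  then have "\<phi> x = 0" if "x \<in> closure \<Omega>" for x
    using continuous_constant_on_closure[OF V_continuous[OF \<phi>(1)]] that by blast
  then show False using \<phi>(2) V_outside[OF \<phi>(1)] by (auto simp: fun_eq_iff)
qed

text \<open>A vanishing Dirichlet integral leaves \<open>\<phi>\<close> constant on each element,
  hence with finitely many values. A continuous function of finite range on a connected set is
  constant, which replaces chains of adjacent elements; a point of \<open>\<Gamma>D\<close> makes
  the constant zero.\<close>

lemma stiffness_positive:
  assumes \<phi>: "\<phi> \<in> V" "\<phi> \<noteq> (\<lambda>_. 0)"
  shows "(\<integral>x. gradient \<phi> x \<bullet> gradient \<phi> x \<partial>lebesgue_on \<Omega>) > 0"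
proof (rule ccontr)
  let ?g = "\<lambda>x. gradient \<phi> x \<bullet> gradient \<phi> x"
  have int: "integrable (lebesgue_on \<Omega>) ?g"
    by (intro integrable_inner_gradient P1_gradient_DG0 V_P1 \<phi>)
  have "0 \<le> (\<integral>x. ?g x \<partial>lebesgue_on \<Omega>)" by (rule Bochner_Integration.integral_nonneg) (rule inner_ge_zero)
  moreover assume "\<not> ?thesis"
  ultimately have "(\<integral>x. ?g x \<partial>lebesgue_on \<Omega>) = 0" by linarith
  then have ae: "AE x in lebesgue_on \<Omega>. ?g x = 0"
    using integral_nonneg_eq_0_iff_AE[OF int] by simp
  have "\<exists>k. \<forall>x\<in>K. \<phi> x = k" if K: "K \<in> \<T>" for K
  proof -
    obtain a c where ac: "\<And>x. x \<in> K \<Longrightarrow> \<phi> x = a \<bullet> x + c" "\<And>x. x \<in> interior K \<Longrightarrow> GDERIV \<phi> x :> a"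
      by (rule P1_affine[OF V_P1[OF \<phi>(1)] K]) blast
    obtain x where "x \<in> interior K \<inter> \<Omega>" "?g x = 0"
      by (rule AE_open_point[OF ae open_interior cell_interior_nonempty[OF K]])
    then have "a = 0" using gradient_eqI[OF ac(2)[of x]] by simp
    then show ?thesis using ac(1) by auto
  qed
  then obtain k where k: "\<And>K x. K \<in> \<T> \<Longrightarrow> x \<in> K \<Longrightarrow> \<phi> x = k K" by metis
  have "\<phi> ` closure \<Omega> \<subseteq> k ` \<T>" using k covers by blast
  then have "finite (\<phi> ` closure \<Omega>)" using finite_\<T> finite_surj by blast
  then have "\<phi> constant_on closure \<Omega>"
    using \<Omega>(2) V_continuous[OF \<phi>(1)] by (intro continuous_finite_range_constant connected_imp_connected_closure) auto
  moreover obtain y where "y \<in> \<Gamma>D" using \<Gamma>D by blast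
  moreover from this have "y \<in> closure \<Omega>" "\<phi> y = 0" using \<Gamma>D(2) \<phi> by (auto simp: frontier_def P1_D_def)
  ultimately have "\<phi> x = 0" if "x \<in> closure \<Omega>" for x using that unfolding constant_on_def by metis
  then show False using \<phi>(2) V_outside[OF \<phi>(1)] by (auto simp: fun_eq_iff)
qed

lemma linear_functional_on_integral:
  assumes "integrable (lebesgue_on \<Omega>) h"
  shows "linear_functional_on V (\<lambda>\<phi>. \<integral>x. h x * \<phi> x \<partial>lebesgue_on \<Omega>)"
proof (rule linear_functional_onI)
  have int: "integrable (lebesgue_on \<Omega>) (\<lambda>x. h x * \<phi> x)" if "\<phi> \<in> V" for \<phi>
    using Linf_integrable_mult[OF V_Linf[OF that] assms] by (simp add: mult.commute)
  show "(\<integral>x. h x * (\<phi> x + \<psi> x) \<partial>lebesgue_on \<Omega>) = (\<integral>x. h x * \<phi> x \<partial>lebesgue_on \<Omega>) + (\<integral>x. h x * \<psi> x \<partial>lebesgue_on \<Omega>)"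
    if "\<phi> \<in> V" "\<psi> \<in> V" for \<phi> \<psi>
    using int that by (simp add: distrib_left)
  show "(\<integral>x. h x * (k * \<phi> x) \<partial>lebesgue_on \<Omega>) = k * (\<integral>x. h x * \<phi> x \<partial>lebesgue_on \<Omega>)" for k \<phi>
    by (simp add: mult.left_commute)
qed

lemma linear_functional_on_integral_gradient:
  assumes "h \<in> DG0 \<T>"
  shows "linear_functional_on V (\<lambda>\<phi>. \<integral>x. h x \<bullet> gradient \<phi> x \<partial>lebesgue_on \<Omega>)"
proof (rule linear_functional_onI)
  note int = integrable_inner_gradient[OF assms]
  show "(\<integral>x. h x \<bullet> gradient (\<lambda>x. \<phi> x + \<psi> x) x \<partial>lebesgue_on \<Omega>)
      = (\<integral>x. h x \<bullet> gradient \<phi> x \<partial>lebesgue_on \<Omega>) + (\<integral>x. h x \<bullet> gradient \<psi> x \<partial>lebesgue_on \<Omega>)"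
    if "\<phi> \<in> V" "\<psi> \<in> V" for \<phi> \<psi>
  proof -
    have "AE x in lebesgue_on \<Omega>. h x \<bullet> gradient (\<lambda>x. \<phi> x + \<psi> x) x = h x \<bullet> gradient \<phi> x + h x \<bullet> gradient \<psi> x"
      by (rule AE_cellI) (simp add: gradient_add that inner_add_right)
    from M.integral_cong_AE_complete[OF this] int that show ?thesis by simp
  qed
  show "(\<integral>x. h x \<bullet> gradient (\<lambda>x. k * \<phi> x) x \<partial>lebesgue_on \<Omega>) = k * (\<integral>x. h x \<bullet> gradient \<phi> x \<partial>lebesgue_on \<Omega>)"
    if "\<phi> \<in> V" for k \<phi>
  proof -
    have "AE x in lebesgue_on \<Omega>. h x \<bullet> gradient (\<lambda>x. k * \<phi> x) x = k * (h x \<bullet> gradient \<phi> x)"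
      by (rule AE_cellI) (simp add: gradient_scale that)
    from M.integral_cong_AE_complete[OF this] show ?thesis by simp
  qed
qed

end

section \<open>The leapfrog scheme\<close>

context finite_element_mesh begin

lemma Linf_subset_integrable: "Linf \<Omega> \<subseteq> {g. integrable (lebesgue_on \<Omega>) g}"
  using Linf_integrable[OF lmeasurable_\<Omega>] by blast

lemmas continuous_on_integral_Linf =
  sepfam_integral[OF M.complete_measure_axioms _ Linf_subset_integrable, THEN conjunct2]

lemma continuous_on_stiffness:
  assumes "V.continuous_family C y" "\<phi> \<in> V"
  shows "continuous_on C (\<lambda>c. \<integral>x. gradient (y c) x \<bullet> gradient \<phi> x \<partial>lebesgue_on \<Omega>)"
proof -
  have "sepfam C (lebesgue_on \<Omega>) (Linf \<Omega>)
      (\<lambda>c x. \<Sum>b\<in>Basis. (gradient (y c) x \<bullet> b) * (gradient \<phi> x \<bullet> b))"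
    by (intro sepfam_sum Linf_const sepfam_Linf_mult
        sepfam_V assms sepfam_const gradient_Linf)
  from continuous_on_integral_Linf[OF this] show ?thesis by (simp only: euclidean_inner[symmetric])
qed

section \<open>Independence of the parameter values on null sets\<close>

context
  fixes \<mu> \<nu> :: "'a \<Rightarrow> real"
  assumes eq: "AE x in lebesgue_on \<Omega>. \<mu> x = \<nu> x"
begin

lemma \<Phi>_cong_AE: "\<Phi> \<Omega> \<Gamma>D \<T> \<eta> p\<^sub>0 p\<^sub>1 \<mu> = \<Phi> \<Omega> \<Gamma>D \<T> \<eta> p\<^sub>0 p\<^sub>1 \<nu>"
proof -
  have "(\<integral>x. (\<eta> x * p\<^sub>0 x + \<mu> x * p\<^sub>1 x) * \<phi> x \<partial>lebesgue_on \<Omega>)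
      = (\<integral>x. (\<eta> x * p\<^sub>0 x + \<nu> x * p\<^sub>1 x) * \<phi> x \<partial>lebesgue_on \<Omega>)" for \<phi>
    by (rule M.integral_cong_AE_complete) (use eq in \<open>eventually_elim, simp\<close>)
  then show ?thesis unfolding \<Phi>_def by simp
qed

text \<open>Equality of the two predicates makes the choice in \<open>leapfrog_p\<close> literally
  the same for both parameters, without appeal to uniqueness of solutions.\<close>

lemma leapfrog_cong_AE:
  "leapfrog \<Omega> \<Gamma>D \<T> T N f \<eta> p\<^sub>0 p\<^sub>1 \<mu> = leapfrog \<Omega> \<Gamma>D \<T> T N f \<eta> p\<^sub>0 p\<^sub>1 \<nu>"
proof -
  have "(\<integral>x. (\<mu> x * \<delta>p_half \<tau> p l x + \<eta> x * p_half p l x) * \<phi> x - u l x \<bullet> gradient \<phi> x \<partial>lebesgue_on \<Omega>)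
      = (\<integral>x. (\<nu> x * \<delta>p_half \<tau> p l x + \<eta> x * p_half p l x) * \<phi> x - u l x \<bullet> gradient \<phi> x \<partial>lebesgue_on \<Omega>)"
    for \<phi> \<tau> p l and u :: "nat \<Rightarrow> 'a \<Rightarrow> 'a"
    by (rule M.integral_cong_AE_complete) (use eq in \<open>eventually_elim, simp\<close>)
  then show ?thesis by (simp add: fun_eq_iff leapfrog_def \<Phi>_cong_AE)
qed

lemma J_cong_AE:
  "J \<Omega> \<Gamma>D \<T> T N f \<eta> p\<^sub>0 p\<^sub>1 m a p_ob reg \<mu> = J \<Omega> \<Gamma>D \<T> T N f \<eta> p\<^sub>0 p\<^sub>1 m a p_ob reg \<nu>"
proof -
  have "(\<integral>x. (norm (\<mu> x))\<^sup>2 \<partial>lebesgue_on \<Omega>) = (\<integral>x. (norm (\<nu> x))\<^sup>2 \<partial>lebesgue_on \<Omega>)"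
    by (rule M.integral_cong_AE_complete) (use eq in \<open>eventually_elim, simp\<close>)
  then have "L2_norm \<Omega> \<mu> = L2_norm \<Omega> \<nu>" by (simp add: L2_norm_def)
  then show ?thesis by (simp only: J_def leapfrog_p_def leapfrog_cong_AE)
qed

end

end

text \<open>The parameters form an abstract separated family with a common positive lower bound, so
  the analysis of the scheme is free of their cell structure. The bound keeps the form solved in
  each time step definite.\<close>

locale leapfrog_family = finite_element_mesh +
  fixes T :: real and N :: nat and f :: "real \<Rightarrow> 'a \<Rightarrow> real" and \<eta> p\<^sub>0 p\<^sub>1 :: "'a \<Rightarrow> real"
    and C :: "'c::topological_space set" and \<nu> :: "'c \<Rightarrow> 'a \<Rightarrow> real" and k :: real
  assumes T: "T > 0" and N: "N \<ge> 1"
    and \<eta>: "\<eta> \<in> Linf \<Omega>" "AE x in lebesgue_on \<Omega>. 0 \<le> \<eta> x"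
    and p\<^sub>0: "p\<^sub>0 \<in> L2 \<Omega>" and p\<^sub>1: "p\<^sub>1 \<in> Linf \<Omega>"
    and sepfam_\<nu>: "sepfam C (lebesgue_on \<Omega>) (Linf \<Omega>) \<nu>"
    and \<nu>_Linf: "c \<in> C \<Longrightarrow> \<nu> c \<in> Linf \<Omega>"
    and k: "k > 0" "c \<in> C \<Longrightarrow> AE x in lebesgue_on \<Omega>. k \<le> \<nu> c x"
begin

definition "\<tau> = T / real N"

lemma \<tau>: "\<tau> > 0"
  using T N by (simp add: \<tau>_def)

section \<open>The scheme as a recursion\<close>

text \<open>Collecting terms, the bracket in the first equation is
  \<open>\<nu> / \<tau> + \<eta> / 2\<close> times the new value minus
  \<open>\<nu> / \<tau> - \<eta> / 2\<close> times the old one. The first weight gives the form to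
  be inverted; the second enters \<open>history\<close>.\<close>

definition "mass c \<phi> \<psi> = (\<integral>x. (\<nu> c x / \<tau> + \<eta> x / 2) * \<phi> x * \<psi> x \<partial>lebesgue_on \<Omega>)"

definition "history c p u \<psi> = (\<integral>x. (\<nu> c x / \<tau> - \<eta> x / 2) * p x * \<psi> x \<partial>lebesgue_on \<Omega>)
  + (\<integral>x. u x \<bullet> gradient \<psi> x \<partial>lebesgue_on \<Omega>)"

text \<open>\<open>L2_integral\<close> is a choice whose integrability against \<open>\<psi>\<close>
  is not established, so linearity of this functional is either deduced from a solution of the
  scheme or assumed.\<close>

definition "load l \<psi> = (\<integral>x. L2_integral \<Omega> {0..t_half T N l} f x * \<psi> x \<partial>lebesgue_on \<Omega>)"

abbreviation "scheme c \<equiv> leapfrog \<Omega> \<Gamma>D \<T> T N f \<eta> p\<^sub>0 p\<^sub>1 (\<nu> c)"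

lemma weight_Linf:
  assumes "c \<in> C"
  shows "(\<lambda>x. \<nu> c x / \<tau> + \<eta> x / 2) \<in> Linf \<Omega>" "(\<lambda>x. \<nu> c x / \<tau> - \<eta> x / 2) \<in> Linf \<Omega>"
  using Linf_add[OF Linf_cmult[OF \<nu>_Linf[OF assms], of "1 / \<tau>"] Linf_cmult[OF \<eta>(1), of "1/2"]]
    Linf_add[OF Linf_cmult[OF \<nu>_Linf[OF assms], of "1 / \<tau>"] Linf_cmult[OF \<eta>(1), of "-1/2"]]
  by simp_all

lemma sepfam_weight:
  "sepfam C (lebesgue_on \<Omega>) (Linf \<Omega>) (\<lambda>c x. \<nu> c x / \<tau> + \<eta> x / 2)"
  "sepfam C (lebesgue_on \<Omega>) (Linf \<Omega>) (\<lambda>c x. \<nu> c x / \<tau> - \<eta> x / 2)"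
  using sepfam_plus[OF sepfam_cmult[OF sepfam_\<nu> continuous_on_const] sepfam_const[OF Linf_cmult[OF \<eta>(1)]], of "1 / \<tau>" "1/2"]
    sepfam_plus[OF sepfam_cmult[OF sepfam_\<nu> continuous_on_const] sepfam_const[OF Linf_cmult[OF \<eta>(1)]], of "1 / \<tau>" "-1/2"]
  by simp_all

lemma mass_linear:
  assumes "c \<in> C"
  shows "\<phi> \<in> V \<Longrightarrow> linear_functional_on V (mass c \<phi>)"
    and "\<psi> \<in> V \<Longrightarrow> linear_functional_on V (\<lambda>\<phi>. mass c \<phi> \<psi>)"
proof -
  have *: "linear_functional_on V (\<lambda>\<psi>. \<integral>x. (\<nu> c x / \<tau> + \<eta> x / 2) * \<phi> x * \<psi> x \<partial>lebesgue_on \<Omega>)" if "\<phi> \<in> V" for \<phi>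
    by (intro linear_functional_on_integral Linf_integrable lmeasurable_\<Omega> Linf_mult weight_Linf assms V_Linf that)
  then show "\<phi> \<in> V \<Longrightarrow> linear_functional_on V (mass c \<phi>)" by (simp add: mass_def[abs_def])
  have "mass c \<phi> \<psi> = mass c \<psi> \<phi>" for \<phi> by (simp add: mass_def mult_ac)
  then show "\<psi> \<in> V \<Longrightarrow> linear_functional_on V (\<lambda>\<phi>. mass c \<phi> \<psi>)" using * by (simp add: mass_def[abs_def])
qed

lemma mass_positive_definite:
  assumes "c \<in> C" "\<phi> \<in> V" "\<phi> \<noteq> (\<lambda>_. 0)"
  shows "mass c \<phi> \<phi> > 0"
  unfolding mass_def
proof (rule mass_positive[OF weight_Linf(1)[OF assms(1)]])
  show "AE x in lebesgue_on \<Omega>. k / \<tau> \<le> \<nu> c x / \<tau> + \<eta> x / 2"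
    using k(2)[OF assms(1)] \<eta>(2)
    by eventually_elim (use \<tau> in \<open>auto intro!: add_increasing2 divide_right_mono\<close>)
qed (use assms k \<tau> in auto)

lemma history_linear:
  assumes "c \<in> C" "p \<in> V" "u \<in> DG0 \<T>"
  shows "linear_functional_on V (history c p u)"
  unfolding history_def[abs_def]
  by (intro linear_functional_on_add linear_functional_on_integral linear_functional_on_integral_gradient
      Linf_integrable lmeasurable_\<Omega> Linf_mult weight_Linf assms V_Linf)

lemma scheme_equation:
  assumes c: "c \<in> C" and p: "p l \<in> V" "p (Suc l) \<in> V" and u: "u l \<in> DG0 \<T>" and \<psi>: "\<psi> \<in> V"
  shows "(\<integral>x. (\<nu> c x * \<delta>p_half \<tau> p l x + \<eta> x * p_half p l x) * \<psi> x - u l x \<bullet> gradient \<psi> x \<partial>lebesgue_on \<Omega>)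
    = mass c (p (Suc l)) \<psi> - history c (p l) (u l) \<psi>"
proof -
  have [simp]: "integrable (lebesgue_on \<Omega>) (\<lambda>x. (\<nu> c x / \<tau> + \<eta> x / 2) * p (Suc l) x * \<psi> x)"
    "integrable (lebesgue_on \<Omega>) (\<lambda>x. (\<nu> c x / \<tau> - \<eta> x / 2) * p l x * \<psi> x)"
    "integrable (lebesgue_on \<Omega>) (\<lambda>x. u l x \<bullet> gradient \<psi> x)"
    by (intro Linf_integrable lmeasurable_\<Omega> Linf_mult weight_Linf V_Linf c p u \<psi> integrable_inner_gradient)+
  have "(\<nu> c x * \<delta>p_half \<tau> p l x + \<eta> x * p_half p l x) * \<psi> x - u l x \<bullet> gradient \<psi> x
     = (\<nu> c x / \<tau> + \<eta> x / 2) * p (Suc l) x * \<psi> x - (\<nu> c x / \<tau> - \<eta> x / 2) * p l x * \<psi> x - u l x \<bullet> gradient \<psi> x" for x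
    using \<tau> by (simp add: \<delta>p_half_def p_half_def field_simps)
  then show ?thesis by (simp add: mass_def history_def)
qed

text \<open>In this marching form, the data of level \<open>l\<close> pose a Galerkin problem for
  \<open>p (Suc l)\<close>, followed by an explicit update of \<open>u\<close>.\<close>

lemma scheme_iff:
  assumes c: "c \<in> C"
  shows "scheme c p u \<longleftrightarrow> (\<forall>l\<le>N. p l \<in> V) \<and> (\<forall>l<N. u l \<in> DG0 \<T>) \<and>
    (\<forall>l<N. \<forall>\<psi>\<in>V. mass c (p (Suc l)) \<psi> = history c (p l) (u l) \<psi> + load l \<psi>) \<and>
    (\<forall>l. Suc l < N \<longrightarrow> (\<forall>K\<in>\<T>. \<forall>x\<in>interior K. u (Suc l) x = u l x - \<tau> *\<^sub>R gradient (p (Suc l)) x)) \<and>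
    p 0 = \<Psi> \<Omega> \<Gamma>D \<T> p\<^sub>0 \<and> (\<forall>K\<in>\<T>. \<forall>x\<in>interior K. u 0 x = \<Phi> \<Omega> \<Gamma>D \<T> \<eta> p\<^sub>0 p\<^sub>1 (\<nu> c) x)"
proof -
  have eqn: "(\<integral>x. (\<nu> c x * \<delta>p_half \<tau> p l x + \<eta> x * p_half p l x) * \<psi> x - u l x \<bullet> gradient \<psi> x \<partial>lebesgue_on \<Omega>)
        = (\<integral>x. L2_integral \<Omega> {0..t_half T N l} f x * \<psi> x \<partial>lebesgue_on \<Omega>)
      \<longleftrightarrow> mass c (p (Suc l)) \<psi> = history c (p l) (u l) \<psi> + load l \<psi>"
    if "\<forall>l\<le>N. p l \<in> V" "\<forall>l<N. u l \<in> DG0 \<T>" "l < N" "\<psi> \<in> V" for l \<psi>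
    using scheme_equation[of c p l u \<psi>] c that by (auto simp: load_def Suc_le_eq)
  have upd: "(v - w) /\<^sub>R \<tau> + g = 0 \<longleftrightarrow> v = w - \<tau> *\<^sub>R g" for v w g :: 'a
  proof -
    have "(v - w) /\<^sub>R \<tau> + g = (1 / \<tau>) *\<^sub>R (v - (w - \<tau> *\<^sub>R g))"
      using \<tau> by (simp add: algebra_simps divide_inverse)
    then show ?thesis using \<tau> by simp
  qed
  \<comment> \<open>Shifting the index replaces the predecessor \<open>l - 1\<close> by a successor,
    as the induction over time levels requires.\<close>
  have idx: "(\<forall>l\<in>{1..<N}. Q l (l - 1)) \<longleftrightarrow> (\<forall>l. Suc l < N \<longrightarrow> Q (Suc l) l)" for Q
    by (metis Suc_le_D atLeastLessThan_iff diff_Suc_1 le_add1 One_nat_def plus_1_eq_Suc)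
  show ?thesis
    unfolding leapfrog_def Let_def \<tau>_def[symmetric] upd
      idx[of "\<lambda>l l'. \<forall>K\<in>\<T>. \<forall>x\<in>interior K. u l x = u l' x - \<tau> *\<^sub>R gradient (p l) x"]
    using eqn by blast
qed

lemma stiffness_linear:
  assumes "\<phi> \<in> V" shows "linear_functional_on V (\<lambda>\<psi>. \<integral>x. gradient \<phi> x \<bullet> gradient \<psi> x \<partial>lebesgue_on \<Omega>)"
    and "linear_functional_on V (\<lambda>\<psi>. \<integral>x. gradient \<psi> x \<bullet> gradient \<phi> x \<partial>lebesgue_on \<Omega>)"
proof -
  show *: "linear_functional_on V (\<lambda>\<psi>. \<integral>x. gradient \<phi> x \<bullet> gradient \<psi> x \<partial>lebesgue_on \<Omega>)"
    by (intro linear_functional_on_integral_gradient P1_gradient_DG0 V_P1 assms)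
  then show "linear_functional_on V (\<lambda>\<psi>. \<integral>x. gradient \<psi> x \<bullet> gradient \<phi> x \<partial>lebesgue_on \<Omega>)"
    by (simp add: inner_commute)
qed

text \<open>Only the right-hand side depends on \<open>c\<close>. Since \<open>p\<^sub>0\<close> is
  merely square integrable, the separated family on that side is taken in the integrable functions
  instead of \<open>Linf\<close>.\<close>

lemma \<Phi>_continuous_family:
  "\<exists>Y. V.continuous_family C Y \<and> (\<forall>c\<in>C. \<Phi> \<Omega> \<Gamma>D \<T> \<eta> p\<^sub>0 p\<^sub>1 (\<nu> c) = gradient (Y c))"
proof -
  let ?B = "\<lambda>\<phi> \<psi>. \<integral>x. gradient \<phi> x \<bullet> gradient \<psi> x \<partial>lebesgue_on \<Omega>"
  let ?l = "\<lambda>c \<psi>. \<integral>x. (\<eta> x * p\<^sub>0 x + \<nu> c x * p\<^sub>1 x) * \<psi> x \<partial>lebesgue_on \<Omega>"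
  let ?L1 = "{g. integrable (lebesgue_on \<Omega>) g}"
  have \<eta>p: "integrable (lebesgue_on \<Omega>) (\<lambda>x. \<eta> x * p\<^sub>0 x)"
    by (intro Linf_integrable_mult \<eta>(1) L2_integrable lmeasurable_\<Omega> p\<^sub>0)
  have "\<exists>Y. V.continuous_family C Y \<and> (\<forall>c\<in>C. \<forall>\<psi>\<in>V. ?B (Y c) \<psi> = ?l c \<psi>)"
  proof (rule V.galerkin_continuous)
    show "linear_functional_on V (?l c)" if "c \<in> C" for c
      using Linf_integrable[OF lmeasurable_\<Omega> Linf_mult[OF \<nu>_Linf[OF that] p\<^sub>1]] \<eta>p
      by (intro linear_functional_on_integral) simp
    show "continuous_on C (\<lambda>c. ?l c \<psi>)" if \<psi>: "\<psi> \<in> V" for \<psi>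
    proof -
      have "sepfam C (lebesgue_on \<Omega>) ?L1 (\<lambda>c x. \<nu> c x * p\<^sub>1 x)"
        by (rule sepfam_mult[OF sepfam_\<nu> sepfam_const, of p\<^sub>1 "Linf \<Omega>"])
          (use p\<^sub>1 Linf_mult Linf_subset_integrable in auto)
      then have "sepfam C (lebesgue_on \<Omega>) ?L1 (\<lambda>c x. \<psi> x * (\<eta> x * p\<^sub>0 x + \<nu> c x * p\<^sub>1 x))"
        using \<eta>p V_Linf[OF \<psi>]
        by (intro sepfam_mult[OF sepfam_const, where \<F> = "Linf \<Omega>" and \<G> = ?L1] sepfam_plus sepfam_const)
          (auto intro: Linf_integrable_mult)
      from sepfam_integral[OF M.complete_measure_axioms this] show ?thesis by (simp add: mult.commute)
    qed
  qed (auto intro: stiffness_linear stiffness_positive)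
  then obtain Y where Y: "V.continuous_family C Y" and sol: "\<And>c \<psi>. c \<in> C \<Longrightarrow> \<psi> \<in> V \<Longrightarrow> ?B (Y c) \<psi> = ?l c \<psi>"
    by blast
  \<comment> \<open>The description in \<open>\<Phi>\<close> is evaluated: the Galerkin solution
    exists, and definiteness makes it unique.\<close>
  have "(THE y. y \<in> V \<and> (\<forall>\<psi>\<in>V. ?B y \<psi> = ?l c \<psi>)) = Y c" if c: "c \<in> C" for c
  proof (rule the_equality)
    have "Y c \<in> V" using Y c by (simp add: V.continuous_family_def)
    then show "Y c \<in> V \<and> (\<forall>\<psi>\<in>V. ?B (Y c) \<psi> = ?l c \<psi>)" using sol c by blast
    fix y assume "y \<in> V \<and> (\<forall>\<psi>\<in>V. ?B y \<psi> = ?l c \<psi>)"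
    then show "y = Y c"
      using \<open>Y c \<in> V\<close> sol[OF c] by (intro V.galerkin_unique[of ?B] stiffness_linear stiffness_positive) auto
  qed
  then have "\<forall>c\<in>C. \<Phi> \<Omega> \<Gamma>D \<T> \<eta> p\<^sub>0 p\<^sub>1 (\<nu> c) = gradient (Y c)"
    by (intro ballI) (simp only: \<Phi>_def)
  with Y show ?thesis by blast
qed

lemma step_continuous_family:
  assumes p: "V.continuous_family C p" and y: "V.continuous_family C y" and r: "linear_functional_on V r"
  shows "\<exists>q. V.continuous_family C q \<and>
    (\<forall>c\<in>C. \<forall>\<psi>\<in>V. mass c (q c) \<psi> = history c (p c) (gradient (y c)) \<psi> + r \<psi>)"
proof (rule V.galerkin_continuous)
  show "continuous_on C (\<lambda>c. mass c \<phi> \<psi>)" if "\<phi> \<in> V" "\<psi> \<in> V" for \<phi> \<psi>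
    unfolding mass_def
    by (intro continuous_on_integral_Linf sepfam_Linf_mult
        sepfam_weight sepfam_const V_Linf that)
  show "continuous_on C (\<lambda>c. history c (p c) (gradient (y c)) \<psi> + r \<psi>)" if "\<psi> \<in> V" for \<psi>
    unfolding history_def
    by (intro continuous_on_add continuous_on_const continuous_on_stiffness[OF y that]
        continuous_on_integral_Linf sepfam_Linf_mult
        sepfam_weight sepfam_const V_Linf that sepfam_V p)
  show "linear_functional_on V (\<lambda>\<psi>. history c (p c) (gradient (y c)) \<psi> + r \<psi>)" if "c \<in> C" for c
    using p y that
    by (intro linear_functional_on_add history_linear r P1_gradient_DG0 V_P1) (simp_all add: V.continuous_family_def)
qed (auto intro: mass_linear mass_positive_definite)

text \<open>Neither conclusion mentions \<open>c\<close>, so solvability for a single parameter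
  secures both for all. The load is linear because the scheme expresses it as a difference of two
  linear functionals.\<close>

lemma scheme_necessary:
  assumes c: "c \<in> C" and "scheme c p u"
  shows "\<Psi> \<Omega> \<Gamma>D \<T> p\<^sub>0 \<in> V" and "l < N \<Longrightarrow> linear_functional_on V (load l)"
proof -
  note s = assms(2)[unfolded scheme_iff[OF c]]
  show "\<Psi> \<Omega> \<Gamma>D \<T> p\<^sub>0 \<in> V" using s by (metis le0)
  assume l: "l < N"
  then have V: "p l \<in> V" "p (Suc l) \<in> V" "u l \<in> DG0 \<T>" using s by auto
  note lin = mass_linear(1)[OF c V(2)] history_linear[OF c V(1,3)]
  have load: "load l \<psi> = mass c (p (Suc l)) \<psi> - history c (p l) (u l) \<psi>" if "\<psi> \<in> V" for \<psi>
    using s l that by simp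
  show "linear_functional_on V (load l)"
    by (rule linear_functional_onI)
      (simp_all add: load V.add V.scale lin[THEN linear_functional_onD(1)] lin[THEN linear_functional_onD(2)] right_diff_distrib)
qed

text \<open>Converse to \<open>scheme_necessary\<close>. The recursion is run on whole families in
  \<open>c\<close>, pairs of \<open>p l\<close> and a potential of \<open>u l\<close>, so that
  continuity is part of the chosen state; uniqueness then identifies these families with the values
  of \<open>leapfrog_p\<close>.\<close>

lemma scheme_solution:
  assumes \<Psi>: "\<Psi> \<Omega> \<Gamma>D \<T> p\<^sub>0 \<in> V" and load: "\<And>l. l < N \<Longrightarrow> linear_functional_on V (load l)"
  obtains P where "\<And>l. V.continuous_family C (P l)"
    "\<And>c l. c \<in> C \<Longrightarrow> l \<le> N \<Longrightarrow> leapfrog_p \<Omega> \<Gamma>D \<T> T N f \<eta> p\<^sub>0 p\<^sub>1 (\<nu> c) l = P l c"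
proof -
  obtain Y where Y: "V.continuous_family C Y"
    and \<Phi>: "\<And>c. c \<in> C \<Longrightarrow> \<Phi> \<Omega> \<Gamma>D \<T> \<eta> p\<^sub>0 p\<^sub>1 (\<nu> c) = gradient (Y c)" using \<Phi>_continuous_family by blast
  \<comment> \<open>From level \<open>N\<close> on the load is replaced by zero, so that the
    recursion runs over all natural numbers.\<close>
  define r where "r l = (if l < N then load l else (\<lambda>_. 0))" for l
  have r: "linear_functional_on V (r l)" for l
    using load by (simp add: r_def linear_functional_on_def)
  define good where "good l s \<longleftrightarrow> V.continuous_family C (fst s) \<and> V.continuous_family C (snd s) \<and>
    (l = 0 \<longrightarrow> s = (\<lambda>_. \<Psi> \<Omega> \<Gamma>D \<T> p\<^sub>0, Y))" for l :: nat and s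
  define step where "step l s s' \<longleftrightarrow>
    (\<forall>c\<in>C. \<forall>\<psi>\<in>V. mass c (fst s' c) \<psi> = history c (fst s c) (gradient (snd s c)) \<psi> + r l \<psi>) \<and>
    snd s' = (\<lambda>c x. snd s c x + (-\<tau>) * fst s' c x)" for l s s'
  have "\<exists>S. \<forall>l. good l (S l) \<and> step l (S l) (S (Suc l))"
  proof (rule dependent_nat_choice)
    show "\<exists>s. good 0 s" using Y \<Psi> by (auto simp: good_def intro: V.continuous_family_const)
    fix s l assume s: "good l s"
    then obtain q where q: "V.continuous_family C q"
      "\<forall>c\<in>C. \<forall>\<psi>\<in>V. mass c (q c) \<psi> = history c (fst s c) (gradient (snd s c)) \<psi> + r l \<psi>"
      using step_continuous_family[OF _ _ r, of "fst s" "snd s" l] by (auto simp: good_def)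
    have "V.continuous_family C (\<lambda>c x. snd s c x + (-\<tau>) * q c x)"
      using s q by (intro V.continuous_family_add V.continuous_family_scale) (simp_all add: good_def)
    with q show "\<exists>s'. good (Suc l) s' \<and> step l s s'"
      by (intro exI[of _ "(q, \<lambda>c x. snd s c x + (-\<tau>) * q c x)"]) (simp add: good_def step_def)
  qed
  then obtain S where S: "\<And>l. good l (S l)" "\<And>l. step l (S l) (S (Suc l))" by blast
  define P y where "P l = fst (S l)" and "y l = snd (S l)" for l
  have fam: "V.continuous_family C (P l)" "V.continuous_family C (y l)" for l
    using S(1)[of l] by (simp_all add: good_def P_def y_def)
  then have V: "P l c \<in> V" "y l c \<in> V" if "c \<in> C" for l c using that by (auto simp: V.continuous_family_def)
  have P0: "P 0 c = \<Psi> \<Omega> \<Gamma>D \<T> p\<^sub>0" and y0: "y 0 = Y" for c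
    using S(1)[of 0] by (simp_all add: good_def P_def y_def)
  have eqn: "mass c (P (Suc l) c) \<psi> = history c (P l c) (gradient (y l c)) \<psi> + load l \<psi>"
    if "c \<in> C" "\<psi> \<in> V" "l < N" for c \<psi> l
    using S(2)[of l] that by (simp add: step_def P_def y_def r_def)
  have upd: "gradient (y (Suc l) c) x = gradient (y l c) x - \<tau> *\<^sub>R gradient (P (Suc l) c) x"
    if "c \<in> C" "K \<in> \<T>" "x \<in> interior K" for c K x l
  proof -
    have "y (Suc l) c = (\<lambda>x. y l c x + (-\<tau>) * P (Suc l) c x)"
      using S(2)[of l] by (simp add: step_def P_def y_def)
    then show ?thesis
      using gradient_add[OF V(2) V.scale[OF V(1)] that(2,3), of c c l "-\<tau>" "Suc l"]
        gradient_scale[OF V(1) that(2,3), of c "-\<tau>" "Suc l"] that(1) by simp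
  qed
  have ex: "scheme c (\<lambda>l. P l c) (\<lambda>l. gradient (y l c))" if c: "c \<in> C" for c
    unfolding scheme_iff[OF c] using V[OF c] P0 y0 eqn[OF c] upd[OF c] \<Phi>[OF c]
    by (auto intro: P1_gradient_DG0 V_P1)
  \<comment> \<open>The claim on \<open>u\<close> is limited to \<open>l < N\<close> and to element
    interiors: \<open>u\<close> has one level less than \<open>p\<close>, and the scheme leaves its
    skeleton values open.\<close>
  have uniq: "p l = P l c \<and> (l < N \<longrightarrow> (\<forall>K\<in>\<T>. \<forall>x\<in>interior K. u l x = gradient (y l c) x))"
    if c: "c \<in> C" and sol: "scheme c p u" and "l \<le> N" for c p u l
    using \<open>l \<le> N\<close>
  proof (induction l)
    case 0
    show ?case using sol[unfolded scheme_iff[OF c]] P0 y0 \<Phi>[OF c] by simp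
  next
    case (Suc l)
    then have l: "l < N" and IH: "p l = P l c" "\<And>K x. K \<in> \<T> \<Longrightarrow> x \<in> interior K \<Longrightarrow> u l x = gradient (y l c) x"
      by auto
    note s = sol[unfolded scheme_iff[OF c]]
    have hist: "history c (p l) (u l) \<psi> = history c (P l c) (gradient (y l c)) \<psi>" for \<psi>
    proof -
      have "(\<integral>x. u l x \<bullet> gradient \<psi> x \<partial>lebesgue_on \<Omega>) = (\<integral>x. gradient (y l c) x \<bullet> gradient \<psi> x \<partial>lebesgue_on \<Omega>)"
        by (intro M.integral_cong_AE_complete AE_cellI) (simp add: IH)
      then show ?thesis by (simp add: history_def IH)
    qed
    have p: "p (Suc l) = P (Suc l) c"
    proof (rule V.galerkin_unique[of "mass c"])
      show "p (Suc l) \<in> V" using s l by (simp add: Suc_le_eq)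
      show "mass c (p (Suc l)) \<psi> = mass c (P (Suc l) c) \<psi>" if "\<psi> \<in> V" for \<psi>
        using s l that hist eqn[OF c that l] by simp
    qed (use V c mass_linear mass_positive_definite in auto)
    then show ?case using s upd[OF c] IH(2) by simp
  qed
  have "leapfrog_p \<Omega> \<Gamma>D \<T> T N f \<eta> p\<^sub>0 p\<^sub>1 (\<nu> c) l = P l c" if "c \<in> C" "l \<le> N" for c l
  proof -
    have "\<exists>p u. scheme c p u" using ex[OF that(1)] by blast
    then obtain u where "scheme c (leapfrog_p \<Omega> \<Gamma>D \<T> T N f \<eta> p\<^sub>0 p\<^sub>1 (\<nu> c)) u"
      unfolding leapfrog_p_def using someI_ex[of "\<lambda>p. \<exists>u. scheme c p u"] by blast
    then show ?thesis using uniq that by blast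
  qed
  with fam(1) show thesis by (rule that)
qed

section \<open>Continuity of the cost\<close>

text \<open>Since \<open>ob\<close> is only square integrable, the square is expanded: the three
  terms are bounded times bounded, bounded times the integrable \<open>a ob\<close>, and a fixed
  integrable function.\<close>

lemma observation_continuous:
  assumes P: "V.continuous_family C P" and Q: "V.continuous_family C Q"
    and a: "a \<in> Linf \<Omega>" and ob: "ob \<in> L2 \<Omega>"
  shows "continuous_on C (\<lambda>c. \<integral>x. a x * ((P c x + Q c x) / 2 - ob x)\<^sup>2 \<partial>lebesgue_on \<Omega>)"
proof -
  let ?L1 = "{g. integrable (lebesgue_on \<Omega>) g}" and ?h = "\<lambda>c x. (1/2) * (P c x + Q c x)"
  have h: "sepfam C (lebesgue_on \<Omega>) (Linf \<Omega>) ?h"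
    by (intro sepfam_V V.continuous_family_scale V.continuous_family_add P Q)
  have aob: "integrable (lebesgue_on \<Omega>) (\<lambda>x. -2 * (a x * ob x))" "integrable (lebesgue_on \<Omega>) (\<lambda>x. a x * (ob x)\<^sup>2)"
    using Linf_integrable_mult[OF a L2_integrable[OF lmeasurable_\<Omega> ob]]
      Linf_integrable_mult[OF a, of "\<lambda>x. (ob x)\<^sup>2"] ob by (simp_all add: L2_def)
  have "sepfam C (lebesgue_on \<Omega>) (Linf \<Omega>) (\<lambda>c x. ?h c x * a x)"
    by (intro sepfam_Linf_mult h sepfam_const a)
  then have "sepfam C (lebesgue_on \<Omega>) ?L1 (\<lambda>c x. ?h c x * (?h c x * a x))"
    by (rule sepfam_mult[OF h]) (use Linf_mult Linf_subset_integrable in blast)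
  moreover have "sepfam C (lebesgue_on \<Omega>) ?L1 (\<lambda>c x. ?h c x * (-2 * (a x * ob x)))"
    by (rule sepfam_mult[OF h sepfam_const, of _ ?L1]) (use aob in \<open>auto intro: Linf_integrable_mult\<close>)
  moreover have "sepfam C (lebesgue_on \<Omega>) ?L1 (\<lambda>c x. a x * (ob x)\<^sup>2)"
    using aob by (intro sepfam_const) simp
  ultimately have "sepfam C (lebesgue_on \<Omega>) ?L1
      (\<lambda>c x. ?h c x * (?h c x * a x) + ?h c x * (-2 * (a x * ob x)) + a x * (ob x)\<^sup>2)"
    by (intro sepfam_plus)
  from sepfam_integral[OF M.complete_measure_axioms this]
  have "continuous_on C (\<lambda>c. \<integral>x. ?h c x * (?h c x * a x) + ?h c x * (-2 * (a x * ob x)) + a x * (ob x)\<^sup>2 \<partial>lebesgue_on \<Omega>)"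
    by simp
  moreover have "?h c x * (?h c x * a x) + ?h c x * (-2 * (a x * ob x)) + a x * (ob x)\<^sup>2
      = a x * ((P c x + Q c x) / 2 - ob x)\<^sup>2" for c x
    by (simp add: power2_eq_square field_simps)
  ultimately show ?thesis by simp
qed

lemma J_continuous:
  assumes a: "\<And>i l. i \<in> {1..m} \<Longrightarrow> l < N \<Longrightarrow> a i (t_half T N l) \<in> Linf \<Omega>"
    and ob: "\<And>i l. i \<in> {1..m} \<Longrightarrow> l < N \<Longrightarrow> p_ob i (t_half T N l) \<in> L2 \<Omega>"
  shows "continuous_on C (\<lambda>c. J \<Omega> \<Gamma>D \<T> T N f \<eta> p\<^sub>0 p\<^sub>1 m a p_ob reg (\<nu> c))"
proof -
  let ?p = "\<lambda>c. leapfrog_p \<Omega> \<Gamma>D \<T> T N f \<eta> p\<^sub>0 p\<^sub>1 (\<nu> c)"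
  let ?D = "\<lambda>i l p. \<integral>x. a i (t_half T N l) x * (p_half p l x - p_ob i (t_half T N l) x)\<^sup>2 \<partial>lebesgue_on \<Omega>"
  have reg: "continuous_on C (\<lambda>c. (L2_norm \<Omega> (\<nu> c))\<^sup>2)"
  proof -
    have "continuous_on C (\<lambda>c. \<integral>x. \<nu> c x * \<nu> c x \<partial>lebesgue_on \<Omega>)"
      by (intro continuous_on_integral_Linf sepfam_Linf_mult sepfam_\<nu>)
    then show ?thesis by (simp add: L2_norm_def power2_eq_square)
  qed
  have "continuous_on C (\<lambda>c. ?D i l (?p c))" if i: "i \<in> {1..m}" and l: "l < N" for i l
  \<comment> \<open>The case condition does not involve \<open>c\<close>, so the same alternative
    holds on all of \<open>C\<close>.\<close>
  proof (cases "\<Psi> \<Omega> \<Gamma>D \<T> p\<^sub>0 \<in> V \<and> (\<forall>l<N. linear_functional_on V (load l))")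
    case True
    then obtain P where P: "\<And>l. V.continuous_family C (P l)" "\<And>c l. c \<in> C \<Longrightarrow> l \<le> N \<Longrightarrow> ?p c l = P l c"
      using scheme_solution by blast
    have "continuous_on C (\<lambda>c. \<integral>x. a i (t_half T N l) x *
        ((P (Suc l) c x + P l c x) / 2 - p_ob i (t_half T N l) x)\<^sup>2 \<partial>lebesgue_on \<Omega>)"
      by (intro observation_continuous P a ob i l)
    then show ?thesis
      by (rule continuous_on_cong[OF refl, THEN iffD1, rotated]) (use P(2) l in \<open>simp add: p_half_def\<close>)
  next
    case False
    \<comment> \<open>By \<open>scheme_necessary\<close> no parameter admits a solution, and \<^const>\<open>leapfrog_p\<close> is the same junk value throughout.\<close>
    then have none: "\<not> scheme c p u" if "c \<in> C" for c p u using scheme_necessary that by blast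
    have "?p c = (SOME p. False)" if "c \<in> C" for c
    proof -
      have "(\<lambda>p. \<exists>u. scheme c p u) = (\<lambda>_. False)" using none[OF that] by blast
      then show ?thesis by (simp only: leapfrog_p_def)
    qed
    then show ?thesis by (simp cong: continuous_on_cong)
  qed
  then show ?thesis
    unfolding J_def Let_def by (intro continuous_intros reg) auto
qed

end

section \<open>Cellwise constant parameters\<close>

text \<open>Tychonoff's theorem over the whole index type: later the indices are all sets, so no
  subtype of mesh elements is required.\<close>

lemma compact_coordinate_box: "compact {c :: 'i \<Rightarrow> real. \<forall>i. a \<le> c i \<and> c i \<le> b}"
proof -
  have "compactin (product_topology (\<lambda>_. euclidean) UNIV) (PiE UNIV (\<lambda>_::'i. {a..b}))"
    by (simp add: compactin_PiE)
  moreover have "PiE UNIV (\<lambda>_::'i. {a..b}) = {c. \<forall>i. a \<le> c i \<and> c i \<le> b}"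
    by (auto simp: PiE_def Pi_def)
  ultimately show ?thesis by (simp add: euclidean_product_topology)
qed

context finite_element_mesh begin

text \<open>The default \<open>k\<close> matters on the skeleton: there the sum of indicators would
  be zero, while \<open>V_ad\<close> bounds the values at every point of \<open>\<Omega>\<close>
  from below.\<close>

definition cell_function :: "real \<Rightarrow> ('a set \<Rightarrow> real) \<Rightarrow> 'a \<Rightarrow> real" where
  "cell_function k c x = (if \<exists>K\<in>\<T>. x \<in> interior K then \<Sum>K\<in>\<T>. c K * indicator (interior K) x else k)"

lemma cell_function_eq: "K \<in> \<T> \<Longrightarrow> x \<in> interior K \<Longrightarrow> cell_function k c x = c K"
  by (auto simp: cell_function_def cell_sum)

lemma cell_function_V_ad:
  assumes "a \<le> b" "\<And>K. a \<le> c K \<and> c K \<le> b"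
  shows "cell_function a c \<in> V_ad \<Omega> \<T> a b"
proof -
  have "cell_function a c constant_on interior K" if "K \<in> \<T>" for K
    using that by (auto simp: constant_on_def cell_function_eq)
  moreover have "a \<le> cell_function a c x \<and> cell_function a c x \<le> b" for x
  proof (cases "\<exists>K\<in>\<T>. x \<in> interior K")
    case True
    then show ?thesis using assms(2) cell_function_eq by metis
  qed (use assms(1) in \<open>simp add: cell_function_def\<close>)
  ultimately show ?thesis by (simp add: V_ad_def DG0_def)
qed

lemma V_ad_cell_function:
  assumes \<mu>: "\<mu> \<in> V_ad \<Omega> \<T> a b" and "a \<le> b"
  obtains c where "\<And>K. a \<le> c K \<and> c K \<le> b" "AE x in lebesgue_on \<Omega>. \<mu> x = cell_function a c x"
proof -
  \<comment> \<open>Indices outside the mesh also receive a value in the interval, so that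
    \<open>c\<close> lies in the full coordinate box.\<close>
  have "\<exists>k. a \<le> k \<and> k \<le> b \<and> (K \<in> \<T> \<longrightarrow> (\<forall>x\<in>interior K. \<mu> x = k))" for K
  proof (cases "K \<in> \<T>")
    case True
    then obtain y where y: "y \<in> interior K" "y \<in> \<Omega>" using cell_interior_nonempty by blast
    have "\<mu> constant_on interior K" using \<mu> True by (simp add: V_ad_def DG0_def)
    then have "\<forall>x\<in>interior K. \<mu> x = \<mu> y" using y(1) unfolding constant_on_def by metis
    moreover have "a \<le> \<mu> y \<and> \<mu> y \<le> b" using \<mu> y(2) by (simp add: V_ad_def)
    ultimately show ?thesis by blast
  qed (use assms(2) in auto)
  then obtain c where c: "\<And>K. a \<le> c K \<and> c K \<le> b \<and> (K \<in> \<T> \<longrightarrow> (\<forall>x\<in>interior K. \<mu> x = c K))" by metis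
  have "AE x in lebesgue_on \<Omega>. \<mu> x = cell_function a c x"
    by (rule AE_cellI) (use c in \<open>simp add: cell_function_eq\<close>)
  with c show thesis using that by blast
qed

lemma sepfam_cell_function: "sepfam C (lebesgue_on \<Omega>) (Linf \<Omega>) (cell_function k)"
proof (rule sepfam_cong)
  show "sepfam C (lebesgue_on \<Omega>) (Linf \<Omega>) (\<lambda>c x. \<Sum>K\<in>\<T>. c K * indicator (interior K) x)"
    by (intro sepfam_sum sepfam_cmult sepfam_const indicator_cell_Linf Linf_const
        continuous_on_subset[OF continuous_on_product_coordinates subset_UNIV])
  show "AE x in lebesgue_on \<Omega>. cell_function k c x = (\<Sum>K\<in>\<T>. c K * indicator (interior K) x)" for c
    by (rule AE_cellI) (simp add: cell_function_eq cell_sum)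
qed

lemma minimizer_exists:
  assumes "T > 0" "N \<ge> 1" "\<eta> \<in> Linf \<Omega>" "AE x in lebesgue_on \<Omega>. 0 \<le> \<eta> x" "p\<^sub>0 \<in> L2 \<Omega>" "p\<^sub>1 \<in> Linf \<Omega>"
    and "\<And>i l. i \<in> {1..m} \<Longrightarrow> l < N \<Longrightarrow> a i (t_half T N l) \<in> Linf \<Omega>"
    and "\<And>i l. i \<in> {1..m} \<Longrightarrow> l < N \<Longrightarrow> p_ob i (t_half T N l) \<in> L2 \<Omega>"
    and \<nu>: "0 < \<nu>min" "\<nu>min \<le> \<nu>max"
  shows "\<exists>\<nu>\<in>V_ad \<Omega> \<T> \<nu>min \<nu>max. \<forall>\<mu>\<in>V_ad \<Omega> \<T> \<nu>min \<nu>max.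
    J \<Omega> \<Gamma>D \<T> T N f \<eta> p\<^sub>0 p\<^sub>1 m a p_ob reg \<nu> \<le> J \<Omega> \<Gamma>D \<T> T N f \<eta> p\<^sub>0 p\<^sub>1 m a p_ob reg \<mu>"
proof -
  define C where "C = {c :: 'a set \<Rightarrow> real. \<forall>K. \<nu>min \<le> c K \<and> c K \<le> \<nu>max}"
  let ?J = "J \<Omega> \<Gamma>D \<T> T N f \<eta> p\<^sub>0 p\<^sub>1 m a p_ob reg"
  interpret leapfrog_family \<Omega> \<Gamma>D \<T> T N f \<eta> p\<^sub>0 p\<^sub>1 C "cell_function \<nu>min" \<nu>min
  proof
    show "cell_function \<nu>min c \<in> Linf \<Omega>" for c
      by (rule cellwise_constant_Linf) (rule cell_function_eq)
    show "AE x in lebesgue_on \<Omega>. \<nu>min \<le> cell_function \<nu>min c x" if "c \<in> C" for c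
      by (rule AE_cellI) (use that in \<open>simp add: C_def cell_function_eq\<close>)
  qed (use assms sepfam_cell_function in auto)
  have "compact C" unfolding C_def by (rule compact_coordinate_box)
  moreover have "(\<lambda>_. \<nu>min) \<in> C" using \<nu> by (simp add: C_def)
  moreover have "continuous_on C (\<lambda>c. ?J (cell_function \<nu>min c))"
    by (rule J_continuous) (use assms in auto)
  ultimately obtain c where c: "c \<in> C"
    and min: "\<And>d. d \<in> C \<Longrightarrow> ?J (cell_function \<nu>min c) \<le> ?J (cell_function \<nu>min d)"
    using continuous_attains_inf[of C "\<lambda>c. ?J (cell_function \<nu>min c)"] by blast
  show ?thesis
  proof (intro bexI[of _ "cell_function \<nu>min c"] ballI)
    show "cell_function \<nu>min c \<in> V_ad \<Omega> \<T> \<nu>min \<nu>max"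
      using c \<nu> by (intro cell_function_V_ad) (auto simp: C_def)
    \<comment> \<open>An admissible \<open>\<mu>\<close> may differ from a cell function on the
      skeleton, but \<open>J\<close> does not see the difference.\<close>
    fix \<mu> assume "\<mu> \<in> V_ad \<Omega> \<T> \<nu>min \<nu>max"
    then obtain d where d: "d \<in> C" "AE x in lebesgue_on \<Omega>. \<mu> x = cell_function \<nu>min d x"
      using V_ad_cell_function[OF _ \<nu>(2)] unfolding C_def by blast
    show "?J (cell_function \<nu>min c) \<le> ?J \<mu>"
      using min[OF d(1)] J_cong_AE[OF d(2)] by simp
  qed
qed

end

section \<open>Application to the given data\<close>

text \<open>The midpoints are the times at which \<open>a\<close> and \<open>p_ob\<close> are
  evaluated; \<open>l + 1/2 \<le> N\<close> keeps them inside the time interval.\<close>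

lemma t_half_in_interval:
  assumes "T > 0" "l < N" shows "t_half T N l \<in> {0..T}"
proof -
  have "t_half T N l = (real l + 1 / 2) * (T / real N)" by (simp add: t_half_def distrib_right add_divide_distrib)
  moreover have "(real l + 1 / 2) * (T / real N) \<le> real N * (T / real N)"
    using assms by (intro mult_right_mono) auto
  ultimately show ?thesis using assms by simp
qed

theorem theorem4p1:
  fixes \<Omega> \<Gamma>D \<Gamma>N :: "'a::euclidean_space set"
    and T \<nu>min \<nu>max reg :: real
    and p\<^sub>0 p\<^sub>1 \<eta> :: "'a \<Rightarrow> real"
    and f :: "real \<Rightarrow> 'a \<Rightarrow> real"
    and m :: nat
    and a p_ob :: "nat \<Rightarrow> real \<Rightarrow> 'a \<Rightarrow> real"
    and H :: "real set" and \<T> :: "real \<Rightarrow> 'a set set"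
  assumes "DIM('a) \<ge> 2"
    and "polyhedral_Lipschitz_domain \<Omega>"
    and "closed \<Gamma>D" and "\<Gamma>D \<subset> frontier \<Omega>" and "\<Gamma>D \<noteq> {}"
    and "\<Gamma>N = frontier \<Omega> - \<Gamma>D" and "hausdorff_measure (DIM('a) - 1) \<Gamma>N \<noteq> 0"
    and "T > 0"
    and "p\<^sub>0 \<in> H1_D \<Omega> \<Gamma>D" and "p\<^sub>1 \<in> Linf \<Omega>"
    and "f \<in> L1_L2 \<Omega> {0..T}"
    and "\<eta> \<in> Linf \<Omega>" and "AE x in lebesgue_on \<Omega>. 0 \<le> \<eta> x"
    and "\<And>i. i \<in> {1..m} \<Longrightarrow> p_ob i \<in> W11_L2 \<Omega> T"
    and "\<And>i. i \<in> {1..m} \<Longrightarrow> a i \<in> C1_Linf \<Omega> T"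
    and "\<And>i t. i \<in> {1..m} \<Longrightarrow> t \<in> {0..T} \<Longrightarrow> AE x in lebesgue_on \<Omega>. 0 \<le> a i t x"
    and "0 < \<nu>min" and "\<nu>min \<le> \<nu>max"
    and "quasi_uniform_family \<Omega> \<Gamma>D \<Gamma>N H \<T>"
  shows "\<forall>h\<in>H. \<forall>N\<ge>1. \<exists>\<nu>\<in>V_ad \<Omega> (\<T> h) \<nu>min \<nu>max. \<forall>\<mu>\<in>V_ad \<Omega> (\<T> h) \<nu>min \<nu>max.
           J \<Omega> \<Gamma>D (\<T> h) T N f \<eta> p\<^sub>0 p\<^sub>1 m a p_ob reg \<nu> \<le> J \<Omega> \<Gamma>D (\<T> h) T N f \<eta> p\<^sub>0 p\<^sub>1 m a p_ob reg \<mu>"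
proof (intro ballI allI impI)
  fix h and N :: nat assume h: "h \<in> H" and N: "N \<ge> 1"
  have mesh: "mesh \<Omega> \<Gamma>D \<Gamma>N (\<T> h)" using assms(19) h by (simp add: quasi_uniform_family_def)
  interpret finite_element_mesh \<Omega> \<Gamma>D "\<T> h"
    using assms(2,4,5) mesh
    by unfold_locales (auto simp: polyhedral_Lipschitz_domain_def Lipschitz_domain_def mesh_def)
  show "\<exists>\<nu>\<in>V_ad \<Omega> (\<T> h) \<nu>min \<nu>max. \<forall>\<mu>\<in>V_ad \<Omega> (\<T> h) \<nu>min \<nu>max.
           J \<Omega> \<Gamma>D (\<T> h) T N f \<eta> p\<^sub>0 p\<^sub>1 m a p_ob reg \<nu> \<le> J \<Omega> \<Gamma>D (\<T> h) T N f \<eta> p\<^sub>0 p\<^sub>1 m a p_ob reg \<mu>"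
  proof (rule minimizer_exists)
    show "p\<^sub>0 \<in> L2 \<Omega>" using assms(9) by (simp add: H1_D_def H1_def)
    show "a i (t_half T N l) \<in> Linf \<Omega>" if "i \<in> {1..m}" "l < N" for i l
      using assms(15)[OF that(1)] t_half_in_interval[OF assms(8) that(2)] by (simp add: C1_Linf_def)
    show "p_ob i (t_half T N l) \<in> L2 \<Omega>" if "i \<in> {1..m}" "l < N" for i l
      using assms(14)[OF that(1)] t_half_in_interval[OF assms(8) that(2)] by (simp add: W11_L2_def)
  qed (use assms N in auto)
qed

end
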